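(* For each pair $(\mathsf{S},\mathsf{L})\in\{(\mathsf{S.ConstCKID},\mathsf{ConstCKID}),(\mathsf{S.ConstCKMP},\mathsf{ConstCKMP}),(\mathsf{S.ConstCKMPID},\mathsf{ConstCKMPID})\}$, a sequent $\Gamma\Rightarrow\Delta$ is derivable in $\mathsf{S}$ if and only if $\iota(\Gamma\Rightarrow\Delta)$ is derivable in $\mathsf{L}$.
   Context: Language $\mathcal{L}$: formulas $\varphi ::= p \mid \bot \mid \varphi\wedge\varphi \mid \varphi\vee\varphi \mid \varphi\to\varphi \mid \varphi \mathrel{\Box\!\!\to} \varphi \mid \varphi \mathrel{\Diamond\!\!\to}\varphi$; $\neg\varphi:=\varphi\to\bot$, $\top:=\neg\bot$, $\varphi\leftrightarrow\psi:=(\varphi\to\psi)\wedge(\psi\to\varphi)$. Hilbert systems: $\mathsf{ConstCK}$ = any axiomatisation of intuitionistic propositional logic in $\mathcal{L}$ with modus ponens, plus CM$_\Box$: $(\varphi\mathrel{\Box\!\!\to}\psi\wedge\chi)\to(\varphi\mathrel{\Box\!\!\to}\psi)\wedge(\varphi\mathrel{\Box\!\!\to}\chi)$; CC$_\Box$: $(\varphi\mathrel{\Box\!\!\to}\psi)\wedge(\varphi\mathrel{\Box\!\!\to}\chi)\to(\varphi\mathrel{\Box\!\!\to}\psi\wedge\chi)$; CN$_\Box$: $\varphi\mathrel{\Box\!\!\to}\top$; CN$_\Diamond$: $\neg(\varphi\mathrel{\Diamond\!\!\to}\bot)$; CK$_\Diamond$: $(\varphi\mathrel{\Box\!\!\to}(\psi\to\chi))\to((\varphi\mathrel{\Diamond\!\!\to}\psi)\to(\varphi\mathrel{\Diamond\!\!\to}\chi))$;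 rules RA$_\Box$: from $\varphi\leftrightarrow\rho$ infer $(\varphi\mathrel{\Box\!\!\to}\psi)\leftrightarrow(\rho\mathrel{\Box\!\!\to}\psi)$; RC$_\Box$: from $\psi\leftrightarrow\chi$ infer $(\varphi\mathrel{\Box\!\!\to}\psi)\leftrightarrow(\varphi\mathrel{\Box\!\!\to}\chi)$; RA$_\Diamond$, RC$_\Diamond$: the same with $\mathrel{\Diamond\!\!\to}$. $\mathsf{ConstCKID}$ = $\mathsf{ConstCK}$ + ID$_\Box$: $\varphi\mathrel{\Box\!\!\to}\varphi$. $\mathsf{ConstCKMP}$ = $\mathsf{ConstCK}$ + MP$_\Box$: $(\varphi\mathrel{\Box\!\!\to}\psi)\to(\varphi\to\psi)$ + MP$_\Diamond$: $\varphi\wedge\psi\to(\varphi\mathrel{\Diamond\!\!\to}\psi)$. $\mathsf{ConstCKMPID}$ = $\mathsf{ConstCK}$ + MP$_\Box$, MP$_\Diamond$, ID$_\Box$. A sequent $\Gamma\Rightarrow\Delta$ is a pair of finite multisets with $|\Delta|\le1$; $\varphi\Leftrightarrow\rho$ abbreviates $\varphi\Rightarrow\rho$ and $\rho\Rightarrow\varphi$. $\iota(\Gamma\Rightarrow\Delta)=\bigwedge\Gamma\to\bigvee\Delta$ if $\Gamma\neq\emptyset$, $\bigvee\Delta$ otherwise, $\bigvee\emptyset=\bot$. Throughout $0\le|\Delta|\le1$, $n\ge0$. Propositional rules (premisses / conclusion): init: $\Gamma,p\Rightarrow p$; $\bot_L$: $\Gamma,\bot\Rightarrow\Delta$; $\wedge_L$: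 $\Gamma,\varphi,\psi\Rightarrow\Delta$ / $\Gamma,\varphi\wedge\psi\Rightarrow\Delta$; $\wedge_R$: $\Gamma\Rightarrow\varphi$, $\Gamma\Rightarrow\psi$ / $\Gamma\Rightarrow\varphi\wedge\psi$; $\vee_L$: $\Gamma,\varphi\Rightarrow\Delta$, $\Gamma,\psi\Rightarrow\Delta$ / $\Gamma,\varphi\vee\psi\Rightarrow\Delta$; $\vee_R^1$: $\Gamma\Rightarrow\varphi$ / $\Gamma\Rightarrow\varphi\vee\psi$; $\vee_R^2$: $\Gamma\Rightarrow\psi$ / $\Gamma\Rightarrow\varphi\vee\psi$; $\to_R$: $\Gamma,\varphi\Rightarrow\psi$ / $\Gamma\Rightarrow\varphi\to\psi$; $\to_L$: $\Gamma,\varphi\to\psi\Rightarrow\varphi$, $\Gamma,\psi\Rightarrow\Delta$ / $\Gamma,\varphi\to\psi\Rightarrow\Delta$. With $B:=\rho_1\mathrel{\Box\!\!\to}\sigma_1,\dots,\rho_n\mathrel{\Box\!\!\to}\sigma_n$, $E:=\{\varphi\Leftrightarrow\rho_i\}_{i\le n}$: $\Box$: $E$, $\sigma_1,\dots,\sigma_n\Rightarrow\psi$ / $\Gamma,B\Rightarrow\varphi\mathrel{\Box\!\!\to}\psi$; $\Diamond$: $E$, $\varphi\Leftrightarrow\eta$, $\sigma_1,\dots,\sigma_n,\psi\Rightarrow\vartheta$ / $\Gamma,B,\varphi\mathrel{\Diamond\!\!\to}\psi\Rightarrow\eta\mathrel{\Diamond\!\!\to}\vartheta$; $\Box\Diamond$: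 $E$, $\sigma_1,\dots,\sigma_n,\psi\Rightarrow$ / $\Gamma,B,\varphi\mathrel{\Diamond\!\!\to}\psi\Rightarrow\Delta$; $\Box^{id}$: $E$, $\sigma_1,\dots,\sigma_n,\varphi\Rightarrow\psi$ / $\Gamma,B\Rightarrow\varphi\mathrel{\Box\!\!\to}\psi$; $\Box\Diamond^{id}$: $E$, $\sigma_1,\dots,\sigma_n,\varphi,\psi\Rightarrow$ / $\Gamma,B,\varphi\mathrel{\Diamond\!\!\to}\psi\Rightarrow\Delta$; $\Diamond^{id}$: $E$, $\varphi\Leftrightarrow\eta$, $\sigma_1,\dots,\sigma_n,\varphi,\psi\Rightarrow\vartheta$ / $\Gamma,B,\varphi\mathrel{\Diamond\!\!\to}\psi\Rightarrow\eta\mathrel{\Diamond\!\!\to}\vartheta$; $\mathsf{mp}_\Box$: $\Gamma,\varphi\mathrel{\Box\!\!\to}\psi\Rightarrow\varphi$, $\Gamma,\varphi\mathrel{\Box\!\!\to}\psi,\psi\Rightarrow\Delta$ / $\Gamma,\varphi\mathrel{\Box\!\!\to}\psi\Rightarrow\Delta$; $\mathsf{mp}_\Diamond$: $\Gamma\Rightarrow\varphi$, $\Gamma\Rightarrow\psi$ / $\Gamma\Rightarrow\varphi\mathrel{\Diamond\!\!\to}\psi$. Calculi: $\mathsf{S.ConstCKID}$ = propositional + $\Box^{id},\Diamond^{id},\Box\Diamond^{id}$; $\mathsf{S.ConstCKMP}$ = propositional + $\Box,\Diamond,\Box\Diamond,\mathsf{mp}_\Box,\mathsf{mp}_\Diamond$;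 $\mathsf{S.ConstCKMPID}$ = propositional + $\Box^{id},\Diamond^{id},\Box\Diamond^{id},\mathsf{mp}_\Box,\mathsf{mp}_\Diamond$. *)

theory Defs
  imports Main "HOL-Library.Multiset"
begin

datatype 'a fm =
    Atom 'a
  | Bot
  | And "'a fm" "'a fm"
  | Or "'a fm" "'a fm"
  | Imp "'a fm" "'a fm"
  | CBox "'a fm" "'a fm"
  | CDia "'a fm" "'a fm"

definition Neg :: "'a fm \<Rightarrow> 'a fm" where "Neg \<phi> = Imp \<phi> Bot"
definition Top :: "'a fm" where "Top = Neg Bot"
definition Iff :: "'a fm \<Rightarrow> 'a fm \<Rightarrow> 'a fm" where
  "Iff \<phi> \<psi> = And (Imp \<phi> \<psi>) (Imp \<psi> \<phi>)"

datatype sys = CKID | CKMP | CKMPID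

fun has_id :: "sys \<Rightarrow> bool" where
  "has_id CKID = True" | "has_id CKMP = False" | "has_id CKMPID = True"

fun has_mp :: "sys \<Rightarrow> bool" where
  "has_mp CKID = False" | "has_mp CKMP = True" | "has_mp CKMPID = True"

inductive hderiv :: "sys \<Rightarrow> 'a fm \<Rightarrow> bool" where
  A1: "hderiv L (Imp \<phi> (Imp \<psi> \<phi>))"
| A2: "hderiv L (Imp (Imp \<phi> (Imp \<psi> \<chi>)) (Imp (Imp \<phi> \<psi>) (Imp \<phi> \<chi>)))"
| A3: "hderiv L (Imp (And \<phi> \<psi>) \<phi>)"
| A4: "hderiv L (Imp (And \<phi> \<psi>) \<psi>)"
| A5: "hderiv L (Imp \<phi> (Imp \<psi> (And \<phi> \<psi>)))"
| A6: "hderiv L (Imp \<phi> (Or \<phi> \<psi>))"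
| A7: "hderiv L (Imp \<psi> (Or \<phi> \<psi>))"
| A8: "hderiv L (Imp (Imp \<phi> \<chi>) (Imp (Imp \<psi> \<chi>) (Imp (Or \<phi> \<psi>) \<chi>)))"
| A9: "hderiv L (Imp Bot \<phi>)"
| MP: "hderiv L (Imp \<phi> \<psi>) \<Longrightarrow> hderiv L \<phi> \<Longrightarrow> hderiv L \<psi>"
| CM_box: "hderiv L (Imp (CBox \<phi> (And \<psi> \<chi>)) (And (CBox \<phi> \<psi>) (CBox \<phi> \<chi>)))"
| CC_box: "hderiv L (Imp (And (CBox \<phi> \<psi>) (CBox \<phi> \<chi>)) (CBox \<phi> (And \<psi> \<chi>)))"
| CN_box: "hderiv L (CBox \<phi> Top)"
| CN_dia: "hderiv L (Neg (CDia \<phi> Bot))"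
| CK_dia: "hderiv L (Imp (CBox \<phi> (Imp \<psi> \<chi>)) (Imp (CDia \<phi> \<psi>) (CDia \<phi> \<chi>)))"
| RA_box: "hderiv L (Iff \<phi> \<rho>) \<Longrightarrow> hderiv L (Iff (CBox \<phi> \<psi>) (CBox \<rho> \<psi>))"
| RC_box: "hderiv L (Iff \<psi> \<chi>) \<Longrightarrow> hderiv L (Iff (CBox \<phi> \<psi>) (CBox \<phi> \<chi>))"
| RA_dia: "hderiv L (Iff \<phi> \<rho>) \<Longrightarrow> hderiv L (Iff (CDia \<phi> \<psi>) (CDia \<rho> \<psi>))"
| RC_dia: "hderiv L (Iff \<psi> \<chi>) \<Longrightarrow> hderiv L (Iff (CDia \<phi> \<psi>) (CDia \<phi> \<chi>))"
| ID_box: "has_id L \<Longrightarrow> hderiv L (CBox \<phi> \<phi>)"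
| MP_box: "has_mp L \<Longrightarrow> hderiv L (Imp (CBox \<phi> \<psi>) (Imp \<phi> \<psi>))"
| MP_dia: "has_mp L \<Longrightarrow> hderiv L (Imp (And \<phi> \<psi>) (CDia \<phi> \<psi>))"

text \<open>A sequent \<Gamma> \<Rightarrow> \<Delta> is a finite multiset \<Gamma> together with a succedent
  \<Delta> of size at most one, represented as an option (None = empty succedent).
  The block B = \<rho>1 []-> \<sigma>1, ..., \<rho>n []-> \<sigma>n is represented by a list of
  pairs (\<rho>i, \<sigma>i).\<close>

definition boxes :: "('a fm \<times> 'a fm) list \<Rightarrow> 'a fm multiset" where
  "boxes bs = mset (map (\<lambda>(r, s). CBox r s) bs)"

definition sigmas :: "('a fm \<times> 'a fm) list \<Rightarrow> 'a fm multiset" where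
  "sigmas bs = mset (map snd bs)"

inductive sderiv :: "sys \<Rightarrow> 'a fm multiset \<Rightarrow> 'a fm option \<Rightarrow> bool" where
  init: "sderiv S (add_mset (Atom p) \<Gamma>) (Some (Atom p))"
| botL: "sderiv S (add_mset Bot \<Gamma>) \<Delta>"
| andL: "sderiv S (add_mset \<phi> (add_mset \<psi> \<Gamma>)) \<Delta> \<Longrightarrow>
         sderiv S (add_mset (And \<phi> \<psi>) \<Gamma>) \<Delta>"
| andR: "sderiv S \<Gamma> (Some \<phi>) \<Longrightarrow> sderiv S \<Gamma> (Some \<psi>) \<Longrightarrow>
         sderiv S \<Gamma> (Some (And \<phi> \<psi>))"
| orL: "sderiv S (add_mset \<phi> \<Gamma>) \<Delta> \<Longrightarrow> sderiv S (add_mset \<psi> \<Gamma>) \<Delta> \<Longrightarrow>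
        sderiv S (add_mset (Or \<phi> \<psi>) \<Gamma>) \<Delta>"
| orR1: "sderiv S \<Gamma> (Some \<phi>) \<Longrightarrow> sderiv S \<Gamma> (Some (Or \<phi> \<psi>))"
| orR2: "sderiv S \<Gamma> (Some \<psi>) \<Longrightarrow> sderiv S \<Gamma> (Some (Or \<phi> \<psi>))"
| impR: "sderiv S (add_mset \<phi> \<Gamma>) (Some \<psi>) \<Longrightarrow> sderiv S \<Gamma> (Some (Imp \<phi> \<psi>))"
| impL: "sderiv S (add_mset (Imp \<phi> \<psi>) \<Gamma>) (Some \<phi>) \<Longrightarrow>
         sderiv S (add_mset \<psi> \<Gamma>) \<Delta> \<Longrightarrow>
         sderiv S (add_mset (Imp \<phi> \<psi>) \<Gamma>) \<Delta>"
| box: "\<not> has_id S \<Longrightarrow>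
        \<forall>(\<rho>, \<sigma>) \<in> set bs. sderiv S {#\<phi>#} (Some \<rho>) \<and> sderiv S {#\<rho>#} (Some \<phi>) \<Longrightarrow>
        sderiv S (sigmas bs) (Some \<psi>) \<Longrightarrow>
        sderiv S (\<Gamma> + boxes bs) (Some (CBox \<phi> \<psi>))"
| dia: "\<not> has_id S \<Longrightarrow>
        \<forall>(\<rho>, \<sigma>) \<in> set bs. sderiv S {#\<phi>#} (Some \<rho>) \<and> sderiv S {#\<rho>#} (Some \<phi>) \<Longrightarrow>
        sderiv S {#\<phi>#} (Some \<eta>) \<Longrightarrow> sderiv S {#\<eta>#} (Some \<phi>) \<Longrightarrow>
        sderiv S (add_mset \<psi> (sigmas bs)) (Some \<theta>) \<Longrightarrow>
        sderiv S (add_mset (CDia \<phi> \<psi>) (\<Gamma> + boxes bs)) (Some (CDia \<eta> \<theta>))"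
| boxdia: "\<not> has_id S \<Longrightarrow>
        \<forall>(\<rho>, \<sigma>) \<in> set bs. sderiv S {#\<phi>#} (Some \<rho>) \<and> sderiv S {#\<rho>#} (Some \<phi>) \<Longrightarrow>
        sderiv S (add_mset \<psi> (sigmas bs)) None \<Longrightarrow>
        sderiv S (add_mset (CDia \<phi> \<psi>) (\<Gamma> + boxes bs)) \<Delta>"
| box_id: "has_id S \<Longrightarrow>
        \<forall>(\<rho>, \<sigma>) \<in> set bs. sderiv S {#\<phi>#} (Some \<rho>) \<and> sderiv S {#\<rho>#} (Some \<phi>) \<Longrightarrow>
        sderiv S (add_mset \<phi> (sigmas bs)) (Some \<psi>) \<Longrightarrow>
        sderiv S (\<Gamma> + boxes bs) (Some (CBox \<phi> \<psi>))"
| dia_id: "has_id S \<Longrightarrow>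
        \<forall>(\<rho>, \<sigma>) \<in> set bs. sderiv S {#\<phi>#} (Some \<rho>) \<and> sderiv S {#\<rho>#} (Some \<phi>) \<Longrightarrow>
        sderiv S {#\<phi>#} (Some \<eta>) \<Longrightarrow> sderiv S {#\<eta>#} (Some \<phi>) \<Longrightarrow>
        sderiv S (add_mset \<phi> (add_mset \<psi> (sigmas bs))) (Some \<theta>) \<Longrightarrow>
        sderiv S (add_mset (CDia \<phi> \<psi>) (\<Gamma> + boxes bs)) (Some (CDia \<eta> \<theta>))"
| boxdia_id: "has_id S \<Longrightarrow>
        \<forall>(\<rho>, \<sigma>) \<in> set bs. sderiv S {#\<phi>#} (Some \<rho>) \<and> sderiv S {#\<rho>#} (Some \<phi>) \<Longrightarrow>
        sderiv S (add_mset \<phi> (add_mset \<psi> (sigmas bs))) None \<Longrightarrow>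
        sderiv S (add_mset (CDia \<phi> \<psi>) (\<Gamma> + boxes bs)) \<Delta>"
| mp_box: "has_mp S \<Longrightarrow>
        sderiv S (add_mset (CBox \<phi> \<psi>) \<Gamma>) (Some \<phi>) \<Longrightarrow>
        sderiv S (add_mset \<psi> (add_mset (CBox \<phi> \<psi>) \<Gamma>)) \<Delta> \<Longrightarrow>
        sderiv S (add_mset (CBox \<phi> \<psi>) \<Gamma>) \<Delta>"
| mp_dia: "has_mp S \<Longrightarrow>
        sderiv S \<Gamma> (Some \<phi>) \<Longrightarrow> sderiv S \<Gamma> (Some \<psi>) \<Longrightarrow>
        sderiv S \<Gamma> (Some (CDia \<phi> \<psi>))"

fun bigAnd :: "'a fm list \<Rightarrow> 'a fm" where
  "bigAnd [] = Top"
| "bigAnd [\<phi>] = \<phi>"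
| "bigAnd (\<phi> # \<psi> # xs) = And \<phi> (bigAnd (\<psi> # xs))"

fun bigOr :: "'a fm option \<Rightarrow> 'a fm" where
  "bigOr None = Bot"
| "bigOr (Some \<phi>) = \<phi>"

text \<open>\<iota>(\<Gamma> \<Rightarrow> \<Delta>), where the multiset \<Gamma> is given by an enumeration xs
  (the conjunction depends on the chosen enumeration only up to provable equivalence).\<close>

definition iota :: "'a fm list \<Rightarrow> 'a fm option \<Rightarrow> 'a fm" where
  "iota xs \<Delta> = (if xs = [] then bigOr \<Delta> else Imp (bigAnd xs) (bigOr \<Delta>))"

end

theory Submission
  imports Defs
begin

text \<open>Soundness is a routine induction once the Hilbert system is presented as a local consequence
  relation with a deduction theorem. Completeness needs cut. No derivation heights are used:
  contraction and cut are proved by induction on the size of the formula, with inner inductions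
  on derivations. A cut is first moved up its left premiss until the cut formula is introduced
  on the right there, and then up its right premiss. The critical modal cuts pit \<open>mp_dia\<close> against
  \<open>dia\<close> or \<open>boxdia\<close>, and \<open>box\<close> against \<open>mp_box\<close>: the antecedent of the conditional is then
  derivable from the context, so by cuts on it every \<open>\<rho>\<^sub>i\<close> of the block is derivable too, and
  \<open>mp_box\<close> releases all the \<open>\<sigma>\<^sub>i\<close>.\<close>

text \<open>The shape of the proof comes from the modal rules: they discard their context and keep
  only the \<sigma>'s of a block. A cut formula \<open>CBox \<alpha> \<beta>\<close> in the block of
  the right premiss therefore cannot simply be passed on to a premiss of that rule. It has to be
  replaced by the block of the rule that introduced it in the left premiss, which is why the left
  premiss is reduced before the right one. The two rules may have different, merely interderivable
  antecedents; their equivalence premisses are composed by cuts on these antecedents, which are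
  smaller than the cut formula.

  Heights can be avoided in contraction because an inverted premiss is only ever contracted on
  proper components, which the outer induction covers.\<close>

section \<open>Modal rules, uniformly with and without identity\<close>

definition ids :: "sys \<Rightarrow> 'a fm \<Rightarrow> 'a fm multiset" where
  "ids S \<phi> = (if has_id S then {#\<phi>#} else {#})"

definition equivs :: "sys \<Rightarrow> 'a fm \<Rightarrow> ('a fm \<times> 'a fm) list \<Rightarrow> bool" where
  "equivs S \<phi> bs \<longleftrightarrow>
    (\<forall>(\<rho>, \<sigma>) \<in> set bs. sderiv S {#\<phi>#} (Some \<rho>) \<and> sderiv S {#\<rho>#} (Some \<phi>))"

lemma boxes_simps [simp]:
  "boxes [] = {#}" "boxes ((\<rho>, \<sigma>) # bs) = add_mset (CBox \<rho> \<sigma>) (boxes bs)"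
  "boxes (as @ bs) = boxes as + boxes bs"
  by (simp_all add: boxes_def)

lemma sigmas_simps [simp]:
  "sigmas [] = {#}" "sigmas ((\<rho>, \<sigma>) # bs) = add_mset \<sigma> (sigmas bs)"
  "sigmas (as @ bs) = sigmas as + sigmas bs"
  by (simp_all add: sigmas_def)

lemma equivs_simps [simp]:
  "equivs S \<phi> []"
  "equivs S \<phi> ((\<rho>, \<sigma>) # bs) \<longleftrightarrow>
    sderiv S {#\<phi>#} (Some \<rho>) \<and> sderiv S {#\<rho>#} (Some \<phi>) \<and> equivs S \<phi> bs"
  "equivs S \<phi> (as @ bs) \<longleftrightarrow> equivs S \<phi> as \<and> equivs S \<phi> bs"
  by (auto simp: equivs_def)

lemma sderiv_box:
  assumes "equivs S \<phi> bs" "sderiv S (ids S \<phi> + sigmas bs) (Some \<psi>)"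
  shows "sderiv S (\<Gamma> + boxes bs) (Some (CBox \<phi> \<psi>))"
  using assms sderiv.box[of S bs \<phi> \<psi> \<Gamma>] sderiv.box_id[of S bs \<phi> \<psi> \<Gamma>]
  by (cases "has_id S") (simp_all add: equivs_def ids_def add_mset_commute)

lemma sderiv_dia:
  assumes "equivs S \<phi> bs" "sderiv S {#\<phi>#} (Some \<eta>)" "sderiv S {#\<eta>#} (Some \<phi>)"
    "sderiv S (ids S \<phi> + add_mset \<psi> (sigmas bs)) (Some \<theta>)"
  shows "sderiv S (add_mset (CDia \<phi> \<psi>) (\<Gamma> + boxes bs)) (Some (CDia \<eta> \<theta>))"
  using assms sderiv.dia[of S bs \<phi> \<eta> \<psi> \<theta> \<Gamma>] sderiv.dia_id[of S bs \<phi> \<eta> \<psi> \<theta> \<Gamma>]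
  by (cases "has_id S") (simp_all add: equivs_def ids_def add_mset_commute)

lemma sderiv_boxdia:
  assumes "equivs S \<phi> bs" "sderiv S (ids S \<phi> + add_mset \<psi> (sigmas bs)) None"
  shows "sderiv S (add_mset (CDia \<phi> \<psi>) (\<Gamma> + boxes bs)) \<Delta>"
  using assms sderiv.boxdia[of S bs \<phi> \<psi> \<Gamma> \<Delta>] sderiv.boxdia_id[of S bs \<phi> \<psi> \<Gamma> \<Delta>]
  by (cases "has_id S") (simp_all add: equivs_def ids_def add_mset_commute)

text \<open>The calculi with and without identity share one induction principle: in the modal rules
  the extra antecedent is present in the form of the multiset \<open>ids S \<phi>\<close>.\<close>

lemma sderiv_induct [consumes 1, case_names init botL andL andR orL orR1 orR2 impR impL
    box dia boxdia mp_box mp_dia]: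
  assumes "sderiv S \<Gamma> \<Delta>"
    and "\<And>p \<Gamma>. P (add_mset (Atom p) \<Gamma>) (Some (Atom p))"
    and "\<And>\<Gamma> \<Delta>. P (add_mset Bot \<Gamma>) \<Delta>"
    and "\<And>\<phi> \<psi> \<Gamma> \<Delta>. sderiv S (add_mset \<phi> (add_mset \<psi> \<Gamma>)) \<Delta> \<Longrightarrow>
      P (add_mset \<phi> (add_mset \<psi> \<Gamma>)) \<Delta> \<Longrightarrow> P (add_mset (And \<phi> \<psi>) \<Gamma>) \<Delta>"
    and "\<And>\<Gamma> \<phi> \<psi>. sderiv S \<Gamma> (Some \<phi>) \<Longrightarrow> P \<Gamma> (Some \<phi>) \<Longrightarrow> sderiv S \<Gamma> (Some \<psi>) \<Longrightarrow>
      P \<Gamma> (Some \<psi>) \<Longrightarrow> P \<Gamma> (Some (And \<phi> \<psi>))"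
    and "\<And>\<phi> \<Gamma> \<Delta> \<psi>. sderiv S (add_mset \<phi> \<Gamma>) \<Delta> \<Longrightarrow> P (add_mset \<phi> \<Gamma>) \<Delta> \<Longrightarrow>
      sderiv S (add_mset \<psi> \<Gamma>) \<Delta> \<Longrightarrow> P (add_mset \<psi> \<Gamma>) \<Delta> \<Longrightarrow> P (add_mset (Or \<phi> \<psi>) \<Gamma>) \<Delta>"
    and "\<And>\<Gamma> \<phi> \<psi>. sderiv S \<Gamma> (Some \<phi>) \<Longrightarrow> P \<Gamma> (Some \<phi>) \<Longrightarrow> P \<Gamma> (Some (Or \<phi> \<psi>))"
    and "\<And>\<Gamma> \<psi> \<phi>. sderiv S \<Gamma> (Some \<psi>) \<Longrightarrow> P \<Gamma> (Some \<psi>) \<Longrightarrow> P \<Gamma> (Some (Or \<phi> \<psi>))"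
    and "\<And>\<phi> \<Gamma> \<psi>. sderiv S (add_mset \<phi> \<Gamma>) (Some \<psi>) \<Longrightarrow> P (add_mset \<phi> \<Gamma>) (Some \<psi>) \<Longrightarrow>
      P \<Gamma> (Some (Imp \<phi> \<psi>))"
    and "\<And>\<phi> \<psi> \<Gamma> \<Delta>. sderiv S (add_mset (Imp \<phi> \<psi>) \<Gamma>) (Some \<phi>) \<Longrightarrow>
      P (add_mset (Imp \<phi> \<psi>) \<Gamma>) (Some \<phi>) \<Longrightarrow> sderiv S (add_mset \<psi> \<Gamma>) \<Delta> \<Longrightarrow>
      P (add_mset \<psi> \<Gamma>) \<Delta> \<Longrightarrow> P (add_mset (Imp \<phi> \<psi>) \<Gamma>) \<Delta>"
    and "\<And>bs \<phi> \<psi> \<Gamma>. equivs S \<phi> bs \<Longrightarrow>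
      \<forall>(\<rho>, \<sigma>) \<in> set bs. P {#\<phi>#} (Some \<rho>) \<and> P {#\<rho>#} (Some \<phi>) \<Longrightarrow>
      sderiv S (ids S \<phi> + sigmas bs) (Some \<psi>) \<Longrightarrow> P (ids S \<phi> + sigmas bs) (Some \<psi>) \<Longrightarrow>
      P (\<Gamma> + boxes bs) (Some (CBox \<phi> \<psi>))"
    and "\<And>bs \<phi> \<eta> \<psi> \<theta> \<Gamma>. equivs S \<phi> bs \<Longrightarrow>
      \<forall>(\<rho>, \<sigma>) \<in> set bs. P {#\<phi>#} (Some \<rho>) \<and> P {#\<rho>#} (Some \<phi>) \<Longrightarrow>
      sderiv S {#\<phi>#} (Some \<eta>) \<Longrightarrow> P {#\<phi>#} (Some \<eta>) \<Longrightarrow>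
      sderiv S {#\<eta>#} (Some \<phi>) \<Longrightarrow> P {#\<eta>#} (Some \<phi>) \<Longrightarrow>
      sderiv S (ids S \<phi> + add_mset \<psi> (sigmas bs)) (Some \<theta>) \<Longrightarrow>
      P (ids S \<phi> + add_mset \<psi> (sigmas bs)) (Some \<theta>) \<Longrightarrow>
      P (add_mset (CDia \<phi> \<psi>) (\<Gamma> + boxes bs)) (Some (CDia \<eta> \<theta>))"
    and "\<And>bs \<phi> \<psi> \<Gamma> \<Delta>. equivs S \<phi> bs \<Longrightarrow>
      \<forall>(\<rho>, \<sigma>) \<in> set bs. P {#\<phi>#} (Some \<rho>) \<and> P {#\<rho>#} (Some \<phi>) \<Longrightarrow>
      sderiv S (ids S \<phi> + add_mset \<psi> (sigmas bs)) None \<Longrightarrow>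
      P (ids S \<phi> + add_mset \<psi> (sigmas bs)) None \<Longrightarrow>
      P (add_mset (CDia \<phi> \<psi>) (\<Gamma> + boxes bs)) \<Delta>"
    and "\<And>\<phi> \<psi> \<Gamma> \<Delta>. has_mp S \<Longrightarrow> sderiv S (add_mset (CBox \<phi> \<psi>) \<Gamma>) (Some \<phi>) \<Longrightarrow>
      P (add_mset (CBox \<phi> \<psi>) \<Gamma>) (Some \<phi>) \<Longrightarrow>
      sderiv S (add_mset \<psi> (add_mset (CBox \<phi> \<psi>) \<Gamma>)) \<Delta> \<Longrightarrow>
      P (add_mset \<psi> (add_mset (CBox \<phi> \<psi>) \<Gamma>)) \<Delta> \<Longrightarrow> P (add_mset (CBox \<phi> \<psi>) \<Gamma>) \<Delta>"
    and "\<And>\<Gamma> \<phi> \<psi>. has_mp S \<Longrightarrow> sderiv S \<Gamma> (Some \<phi>) \<Longrightarrow> P \<Gamma> (Some \<phi>) \<Longrightarrow>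
      sderiv S \<Gamma> (Some \<psi>) \<Longrightarrow> P \<Gamma> (Some \<psi>) \<Longrightarrow> P \<Gamma> (Some (CDia \<phi> \<psi>))"
  shows "P \<Gamma> \<Delta>"
  using assms(1)
proof (induction S\<equiv>S \<Gamma> \<Delta> rule: sderiv.induct)
  case (box bs \<phi> \<psi> \<Gamma>)
  show ?case by (rule assms(11)) (use box in \<open>force simp: ids_def equivs_def add_mset_commute\<close>)+
next
  case (box_id bs \<phi> \<psi> \<Gamma>)
  show ?case by (rule assms(11)) (use box_id in \<open>force simp: ids_def equivs_def add_mset_commute\<close>)+
next
  case (dia bs \<phi> \<eta> \<psi> \<theta> \<Gamma>)
  show ?case by (rule assms(12)) (use dia in \<open>force simp: ids_def equivs_def add_mset_commute\<close>)+
next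
  case (dia_id bs \<phi> \<eta> \<psi> \<theta> \<Gamma>)
  show ?case by (rule assms(12)) (use dia_id in \<open>force simp: ids_def equivs_def add_mset_commute\<close>)+
next
  case (boxdia bs \<phi> \<psi> \<Gamma> \<Delta>)
  show ?case by (rule assms(13)) (use boxdia in \<open>force simp: ids_def equivs_def add_mset_commute\<close>)+
next
  case (boxdia_id bs \<phi> \<psi> \<Gamma> \<Delta>)
  show ?case by (rule assms(13)) (use boxdia_id in \<open>force simp: ids_def equivs_def add_mset_commute\<close>)+
qed (blast intro: assms(2-10) assms(14-15))+

lemma sderiv_init: "Atom p \<in># \<Gamma> \<Longrightarrow> sderiv S \<Gamma> (Some (Atom p))"
  by (metis multi_member_split sderiv.init)

lemma sderiv_botL: "Bot \<in># \<Gamma> \<Longrightarrow> sderiv S \<Gamma> \<Delta>"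
  by (metis multi_member_split sderiv.botL)

subsection \<open>Structural rules\<close>

text \<open>The modal rules end in an arbitrary side context, which absorbs \<Theta> without
  touching their premisses; the other rules pass \<Theta> upwards.\<close>

lemma weakening: "sderiv S \<Gamma> \<Delta> \<Longrightarrow> sderiv S (\<Gamma> + \<Theta>) \<Delta>"
proof (induction rule: sderiv_induct)
  case (box bs \<phi> \<psi> \<Gamma>)
  then show ?case using sderiv_box[of S \<phi> bs \<psi> "\<Gamma> + \<Theta>"] by (simp add: ac_simps)
next
  case (dia bs \<phi> \<eta> \<psi> \<theta> \<Gamma>)
  then show ?case using sderiv_dia[of S \<phi> bs \<eta> \<psi> \<theta> "\<Gamma> + \<Theta>"] by (simp add: ac_simps)
next
  case (boxdia bs \<phi> \<psi> \<Gamma> \<Delta>)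
  then show ?case using sderiv_boxdia[of S \<phi> bs \<psi> "\<Gamma> + \<Theta>"] by (simp add: ac_simps)
qed (auto intro: sderiv.intros)

lemma weakening_subset: "sderiv S \<Gamma> \<Delta> \<Longrightarrow> \<Gamma> \<subseteq># \<Gamma>' \<Longrightarrow> sderiv S \<Gamma>' \<Delta>"
  by (metis weakening subset_mset.add_diff_inverse)

text \<open>Only left rules can end in an empty succedent. They copy the succedent to a premiss,
  except for \<open>botL\<close> and \<open>boxdia\<close>, whose conclusions allow any
  succedent.\<close>

lemma weakening_right: "sderiv S \<Gamma> None \<Longrightarrow> sderiv S \<Gamma> \<Delta>"
proof (induction \<Gamma> "None :: 'a fm option" rule: sderiv_induct)
  case (boxdia bs \<phi> \<psi> \<Gamma>)
  then show ?case by (intro sderiv_boxdia)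
qed (simp_all add: sderiv.botL sderiv.andL sderiv.orL sderiv.impL sderiv.mp_box)

section \<open>Locating a formula in the conclusion of a rule\<close>

lemma add_mset_eq_add_msetE:
  assumes "add_mset B \<Gamma> = add_mset A \<Gamma>'"
  obtains (eq) "A = B" "\<Gamma>' = \<Gamma>"
    | (neq) \<Theta> where "\<Gamma> = add_mset A \<Theta>" "\<Gamma>' = add_mset B \<Theta>"
  using assms by (metis add_eq_conv_ex)

text \<open>A formula in the conclusion of a modal rule sits in the discarded context or in the
  block. In the second case \<open>as\<close> is \<open>bs\<close> with one matching pair removed;
  the equation on sets is all that the equivalence premisses need.\<close>

lemma union_boxes_eq_add_msetE:
  assumes "\<Gamma> + boxes bs = add_mset A \<Gamma>'"
  obtains (side) \<Theta> where "\<Gamma> = add_mset A \<Theta>" "\<Gamma>' = \<Theta> + boxes bs"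
    | (block) \<rho> \<sigma> as where "A = CBox \<rho> \<sigma>" "boxes bs = add_mset A (boxes as)"
      "sigmas bs = add_mset \<sigma> (sigmas as)" "\<Gamma>' = \<Gamma> + boxes as" "set bs = insert (\<rho>, \<sigma>) (set as)"
proof -
  have "A \<in># \<Gamma> + boxes bs" using assms by simp
  then consider "A \<in># \<Gamma>" | "A \<in># boxes bs" by auto
  then show thesis
  proof cases
    case 1
    then obtain \<Theta> where "\<Gamma> = add_mset A \<Theta>" by (metis multi_member_split)
    with assms show thesis by (intro side[of \<Theta>]) auto
  next
    case 2
    then obtain \<rho> \<sigma> where A: "A = CBox \<rho> \<sigma>" "(\<rho>, \<sigma>) \<in> set bs" by (auto simp: boxes_def)
    then obtain bs1 bs2 where bs: "bs = bs1 @ (\<rho>, \<sigma>) # bs2" by (metis split_list)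
    show thesis
      by (rule block[of \<rho> \<sigma> "bs1 @ bs2"]) (use assms A bs in auto)
  qed
qed

lemma equivs_insert:
  assumes "equivs S \<phi> bs" "set bs = insert (\<rho>, \<sigma>) (set as)"
  shows "equivs S \<phi> as" "sderiv S {#\<phi>#} (Some \<rho>)" "sderiv S {#\<rho>#} (Some \<phi>)"
  using assms by (auto simp: equivs_def)

section \<open>Inversion of the propositional left rules\<close>

text \<open>One relation lets a single induction prove all inversions. An implication contributes
  only its succedent part, from the right premiss of \<open>impL\<close>; conditionals, atoms and
  \<open>Bot\<close> have no entry, so they never arise as the inverted formula.\<close>

inductive left_part :: "'a fm \<Rightarrow> 'a fm multiset \<Rightarrow> bool" where
  "left_part (And \<phi> \<psi>) {#\<phi>, \<psi>#}"
| "left_part (Or \<phi> \<psi>) {#\<phi>#}"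
| "left_part (Or \<phi> \<psi>) {#\<psi>#}"
| "left_part (Imp \<phi> \<psi>) {#\<psi>#}"

inductive_cases left_partE [elim!]:
  "left_part (Atom p) \<Theta>" "left_part Bot \<Theta>" "left_part (And \<phi> \<psi>) \<Theta>" "left_part (Or \<phi> \<psi>) \<Theta>"
  "left_part (Imp \<phi> \<psi>) \<Theta>" "left_part (CBox \<phi> \<psi>) \<Theta>" "left_part (CDia \<phi> \<psi>) \<Theta>"

text \<open>If A is principal, the wanted sequent is a premiss. In a modal rule A is not a
  conditional, so it lies in the discarded context and can be exchanged for \<Theta> at
  once.\<close>

lemma left_inversion:
  assumes "sderiv S (add_mset A \<Gamma>) \<Delta>" "left_part A \<Theta>"
  shows "sderiv S (\<Theta> + \<Gamma>) \<Delta>"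
  using assms(1)
proof (induction "add_mset A \<Gamma>" \<Delta> arbitrary: \<Gamma> rule: sderiv_induct)
  case (init p \<Gamma>0)
  then show ?case
    by (cases rule: add_mset_eq_add_msetE) (use assms(2) in \<open>auto intro: sderiv.init\<close>)
next
  case (botL \<Gamma>0)
  then show ?case
    by (cases rule: add_mset_eq_add_msetE) (use assms(2) in \<open>auto intro: sderiv.botL\<close>)
next
  case (andL \<phi> \<psi> \<Gamma>0 \<Delta>)
  from andL(3) show ?case
  proof (cases rule: add_mset_eq_add_msetE)
    case eq
    then show ?thesis using andL(1) assms(2) by auto
  next
    case (neq \<Xi>)
    then show ?thesis
      using andL(2)[of "add_mset \<phi> (add_mset \<psi> \<Xi>)"] by (auto intro!: sderiv.andL simp: add_mset_commute)
  qed
next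
  case (orL \<phi> \<Gamma>0 \<Delta> \<psi>)
  from orL(5) show ?case
  proof (cases rule: add_mset_eq_add_msetE)
    case eq
    then show ?thesis using orL(1,3) assms(2) by auto
  next
    case (neq \<Xi>)
    then show ?thesis
      using orL(2)[of "add_mset \<phi> \<Xi>"] orL(4)[of "add_mset \<psi> \<Xi>"]
      by (auto intro!: sderiv.orL simp: add_mset_commute)
  qed
next
  case (impL \<phi> \<psi> \<Gamma>0 \<Delta>)
  from impL(5) show ?case
  proof (cases rule: add_mset_eq_add_msetE)
    case eq
    then show ?thesis using impL(3) assms(2) by auto
  next
    case (neq \<Xi>)
    then show ?thesis
      using impL(2)[of "add_mset (Imp \<phi> \<psi>) \<Xi>"] impL(4)[of "add_mset \<psi> \<Xi>"]
      by (auto intro!: sderiv.impL simp: add_mset_commute)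
  qed
next
  case (mp_box \<phi> \<psi> \<Gamma>0 \<Delta>)
  from mp_box(6) show ?case
  proof (cases rule: add_mset_eq_add_msetE)
    case eq
    then show ?thesis using assms(2) by auto
  next
    case (neq \<Xi>)
    then show ?thesis
      using mp_box(1) mp_box(3)[of "add_mset (CBox \<phi> \<psi>) \<Xi>"]
        mp_box(5)[of "add_mset \<psi> (add_mset (CBox \<phi> \<psi>) \<Xi>)"]
      by (auto intro!: sderiv.mp_box simp: add_mset_commute)
  qed
next
  case (impR \<phi> \<psi>)
  then show ?case using impR(2)[of "add_mset \<phi> \<Gamma>"] by (auto intro!: sderiv.impR simp: add_mset_commute)
next
  case (box bs \<phi> \<psi> \<Gamma>0)
  from box(5) show ?case
  proof (cases rule: union_boxes_eq_add_msetE)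
    case (side \<Xi>)
    then show ?thesis using sderiv_box[OF box(1,3), of "\<Theta> + \<Xi>"] by (simp add: ac_simps)
  next
    case block
    then show ?thesis using assms(2) by auto
  qed
next
  case (dia bs \<phi> \<eta> \<psi> \<theta> \<Gamma>0)
  from dia(9) show ?case
  proof (cases rule: add_mset_eq_add_msetE)
    case eq
    then show ?thesis using assms(2) by auto
  next
    case (neq \<Xi>)
    from neq(1) show ?thesis
    proof (cases rule: union_boxes_eq_add_msetE)
      case (side \<Xi>')
      then show ?thesis
        using neq sderiv_dia[OF dia(1,3,5,7), of "\<Theta> + \<Xi>'"] by (simp add: ac_simps)
    next
      case block
      then show ?thesis using assms(2) by auto
    qed
  qed
next
  case (boxdia bs \<phi> \<psi> \<Gamma>0 \<Delta>)
  from boxdia(5) show ?case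
  proof (cases rule: add_mset_eq_add_msetE)
    case eq
    then show ?thesis using assms(2) by auto
  next
    case (neq \<Xi>)
    from neq(1) show ?thesis
    proof (cases rule: union_boxes_eq_add_msetE)
      case (side \<Xi>')
      then show ?thesis
        using neq sderiv_boxdia[OF boxdia(1,3), of "\<Theta> + \<Xi>'"] by (simp add: ac_simps)
    next
      case block
      then show ?thesis using assms(2) by auto
    qed
  qed
qed (auto intro: sderiv.andR sderiv.orR1 sderiv.orR2 sderiv.mp_dia)

section \<open>Contraction\<close>

lemma add_mset_eq_add_mset2E:
  assumes "add_mset B \<Gamma> = add_mset A (add_mset A \<Gamma>')"
  obtains (eq) "A = B" "\<Gamma> = add_mset A \<Gamma>'"
    | (neq) \<Theta> where "\<Gamma> = add_mset A (add_mset A \<Theta>)" "\<Gamma>' = add_mset B \<Theta>"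
  using assms by (metis add_eq_conv_ex)

text \<open>If a copy of A lies in the context, it is deleted there and the block stays as it is.
  Only when both copies lie in the block does a pair have to go, and then one of two equal
  \<sigma>'s in the premiss must be contracted.\<close>

lemma union_boxes_eq_add_mset2E:
  assumes "\<Gamma> + boxes bs = add_mset A (add_mset A \<Gamma>')"
  obtains \<Theta> as where "add_mset A \<Gamma>' = \<Theta> + boxes as" "set as \<subseteq> set bs"
    "sigmas as = sigmas bs \<or> (\<exists>\<rho> \<sigma> \<Xi>. A = CBox \<rho> \<sigma> \<and>
      sigmas bs = add_mset \<sigma> (add_mset \<sigma> \<Xi>) \<and> sigmas as = add_mset \<sigma> \<Xi>)"
  using assms
proof (cases rule: union_boxes_eq_add_msetE)
  case (side \<Theta>)
  then show thesis using that[of \<Theta> bs] by simp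
next
  case (block \<rho> \<sigma> as)
  from block(4)[symmetric] show thesis
  proof (cases rule: union_boxes_eq_add_msetE)
    case (side \<Theta>)
    then show thesis using that[of \<Theta> bs] block by simp
  next
    case (block \<rho>' \<sigma>' as')
    then show thesis using that[of \<Gamma> as] \<open>A = CBox \<rho> \<sigma>\<close>
      \<open>sigmas bs = _\<close> \<open>set bs = _\<close> by auto
  qed
qed

lemma contraction: "sderiv S (add_mset A (add_mset A \<Gamma>)) \<Delta> \<Longrightarrow> sderiv S (add_mset A \<Gamma>) \<Delta>"
proof (induction A arbitrary: \<Gamma> \<Delta> rule: measure_induct_rule[of size])
  case (less A)
  \<comment> \<open>A doubled \<sigma> is a component of A, so the outer induction merges
    it.\<close>
  have sub: "sderiv S (\<Xi> + sigmas as) D"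
    if "sigmas as = sigmas bs \<or> (\<exists>\<rho> \<sigma> \<Theta>. A = CBox \<rho> \<sigma> \<and>
        sigmas bs = add_mset \<sigma> (add_mset \<sigma> \<Theta>) \<and> sigmas as = add_mset \<sigma> \<Theta>)"
      "sderiv S (\<Xi> + sigmas bs) D" for \<Xi> D and as bs :: "('a fm \<times> 'a fm) list"
    using that less.IH by auto
  have mono: "equivs S \<phi> as" if "equivs S \<phi> bs" "set as \<subseteq> set bs" for as bs \<phi>
    using that by (auto simp: equivs_def)
  from less.prems show ?case
  proof (induction "add_mset A (add_mset A \<Gamma>)" \<Delta> arbitrary: \<Gamma> rule: sderiv_induct)
    case (init p \<Gamma>0)
    then show ?case by (cases rule: add_mset_eq_add_mset2E) (auto intro: sderiv_init)
  next
    case (botL \<Gamma>0)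
    then show ?case by (cases rule: add_mset_eq_add_mset2E) (auto intro: sderiv_botL)
  next
    case (andL \<phi> \<psi> \<Gamma>0 \<Delta>)
    from andL(3) show ?case
    proof (cases rule: add_mset_eq_add_mset2E)
      case eq
      \<comment> \<open>The rule has split one copy of the conjunction; inversion splits the other,
        and both components are contracted by the outer induction.\<close>
      have "sderiv S ({#\<phi>, \<psi>#} + add_mset \<phi> (add_mset \<psi> \<Gamma>)) \<Delta>"
        by (rule left_inversion[of S "And \<phi> \<psi>"])
          (use andL(1) eq in \<open>auto intro: left_part.intros simp: add_mset_commute\<close>)
      then have "sderiv S (add_mset \<phi> (add_mset \<phi> (add_mset \<psi> (add_mset \<psi> \<Gamma>)))) \<Delta>"
        by (simp add: add_mset_commute)
      then have "sderiv S (add_mset \<psi> (add_mset \<psi> (add_mset \<phi> \<Gamma>))) \<Delta>"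
        using less.IH[of \<phi> "add_mset \<psi> (add_mset \<psi> \<Gamma>)" \<Delta>] eq by (simp add: add_mset_commute)
      then have "sderiv S (add_mset \<phi> (add_mset \<psi> \<Gamma>)) \<Delta>"
        using less.IH[of \<psi> "add_mset \<phi> \<Gamma>" \<Delta>] eq by (simp add: add_mset_commute)
      then show ?thesis using eq by (auto intro: sderiv.andL)
    next
      case (neq \<Xi>)
      then show ?thesis
        using andL(2)[of "add_mset \<phi> (add_mset \<psi> \<Xi>)"]
          sderiv.andL[of S \<phi> \<psi> "add_mset A \<Xi>"] by (simp add: add_mset_commute)
    qed
  next
    case (orL \<phi> \<Gamma>0 \<Delta> \<psi>)
    from orL(5) show ?case
    proof (cases rule: add_mset_eq_add_mset2E)
      case eq
      have "sderiv S ({#\<phi>#} + add_mset \<phi> \<Gamma>) \<Delta>"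
        by (rule left_inversion[of S "Or \<phi> \<psi>"])
          (use orL(1) eq in \<open>auto intro: left_part.intros simp: add_mset_commute\<close>)
      moreover have "sderiv S ({#\<psi>#} + add_mset \<psi> \<Gamma>) \<Delta>"
        by (rule left_inversion[of S "Or \<phi> \<psi>"])
          (use orL(3) eq in \<open>auto intro: left_part.intros simp: add_mset_commute\<close>)
      ultimately show ?thesis
        using less.IH[of \<phi> \<Gamma> \<Delta>] less.IH[of \<psi> \<Gamma> \<Delta>] eq by (simp add: sderiv.orL)
    next
      case (neq \<Xi>)
      then show ?thesis
        using orL(2)[of "add_mset \<phi> \<Xi>"] orL(4)[of "add_mset \<psi> \<Xi>"]
          sderiv.orL[of S \<phi> "add_mset A \<Xi>" \<Delta> \<psi>] by (simp add: add_mset_commute)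
    qed
  next
    case (impL \<phi> \<psi> \<Gamma>0 \<Delta>)
    from impL(5) show ?case
    proof (cases rule: add_mset_eq_add_mset2E)
      case eq
      have "sderiv S ({#\<psi>#} + add_mset \<psi> \<Gamma>) \<Delta>"
        by (rule left_inversion[of S "Imp \<phi> \<psi>"])
          (use impL(3) eq in \<open>auto intro: left_part.intros simp: add_mset_commute\<close>)
      then show ?thesis
        using less.IH[of \<psi> \<Gamma> \<Delta>] impL(2)[of \<Gamma>] eq by (simp add: sderiv.impL)
    next
      case (neq \<Xi>)
      then show ?thesis
        using impL(2)[of "add_mset (Imp \<phi> \<psi>) \<Xi>"] impL(4)[of "add_mset \<psi> \<Xi>"]
          sderiv.impL[of S \<phi> \<psi> "add_mset A \<Xi>" \<Delta>] by (simp add: add_mset_commute)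
    qed
  next
    case (mp_box \<phi> \<psi> \<Gamma>0 \<Delta>)
    from mp_box(6) show ?case
    proof (cases rule: add_mset_eq_add_mset2E)
      case eq
      then show ?thesis
        using mp_box(1) mp_box(3)[of \<Gamma>] mp_box(5)[of "add_mset \<psi> \<Gamma>"]
          sderiv.mp_box[of S \<phi> \<psi> \<Gamma> \<Delta>] by (simp add: add_mset_commute)
    next
      case (neq \<Xi>)
      then show ?thesis
        using mp_box(1) mp_box(3)[of "add_mset (CBox \<phi> \<psi>) \<Xi>"]
          mp_box(5)[of "add_mset \<psi> (add_mset (CBox \<phi> \<psi>) \<Xi>)"]
          sderiv.mp_box[of S \<phi> \<psi> "add_mset A \<Xi>" \<Delta>] by (simp add: add_mset_commute)
    qed
  next
    case (impR \<phi> \<psi>)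
    then show ?case
      using impR(2)[of "add_mset \<phi> \<Gamma>"] by (auto intro!: sderiv.impR simp: add_mset_commute)
  next
    case (box bs \<phi> \<psi> \<Gamma>0)
    from box(5) obtain \<Theta> as where as: "add_mset A \<Gamma> = \<Theta> + boxes as" "set as \<subseteq> set bs"
      "sigmas as = sigmas bs \<or> (\<exists>\<rho> \<sigma> \<Xi>. A = CBox \<rho> \<sigma> \<and>
        sigmas bs = add_mset \<sigma> (add_mset \<sigma> \<Xi>) \<and> sigmas as = add_mset \<sigma> \<Xi>)"
      by (rule union_boxes_eq_add_mset2E)
    show ?case unfolding as(1)
      by (rule sderiv_box[OF mono[OF box(1) as(2)] sub[OF as(3) box(3)]])
  next
    case (dia bs \<phi> \<eta> \<psi> \<theta> \<Gamma>0)
    from dia(9) show ?case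
    proof (cases rule: add_mset_eq_add_mset2E)
      case eq
      \<comment> \<open>The second copy of a principal \<open>CDia\<close> can only lie in the
        discarded context, since blocks consist of \<open>CBox\<close> formulas.\<close>
      from eq(2) show ?thesis
      proof (cases rule: union_boxes_eq_add_msetE)
        case (side \<Xi>)
        then show ?thesis using eq sderiv_dia[OF dia(1,3,5,7), of "\<Xi>"] by simp
      next
        case block
        then show ?thesis using eq by simp
      qed
    next
      case (neq \<Xi>)
      from neq(1) obtain \<Theta> as where as: "add_mset A \<Xi> = \<Theta> + boxes as" "set as \<subseteq> set bs"
        "sigmas as = sigmas bs \<or> (\<exists>\<rho> \<sigma> \<Xi>. A = CBox \<rho> \<sigma> \<and>
          sigmas bs = add_mset \<sigma> (add_mset \<sigma> \<Xi>) \<and> sigmas as = add_mset \<sigma> \<Xi>)"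
        by (rule union_boxes_eq_add_mset2E)
      show ?thesis
        using sderiv_dia[OF mono[OF dia(1) as(2)] dia(3,5), of \<psi> \<theta> \<Theta>]
          sub[OF as(3), of "add_mset \<psi> (ids S \<phi>)"] dia(7)
        unfolding neq(2) add_mset_commute[of A "CDia \<phi> \<psi>"] as(1) by simp
    qed
  next
    case (boxdia bs \<phi> \<psi> \<Gamma>0 \<Delta>)
    from boxdia(5) show ?case
    proof (cases rule: add_mset_eq_add_mset2E)
      case eq
      from eq(2) show ?thesis
      proof (cases rule: union_boxes_eq_add_msetE)
        case (side \<Xi>)
        then show ?thesis using eq sderiv_boxdia[OF boxdia(1,3), of "\<Xi>"] by simp
      next
        case block
        then show ?thesis using eq by simp
      qed
    next
      case (neq \<Xi>)
      from neq(1) obtain \<Theta> as where as: "add_mset A \<Xi> = \<Theta> + boxes as" "set as \<subseteq> set bs"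
        "sigmas as = sigmas bs \<or> (\<exists>\<rho> \<sigma> \<Xi>. A = CBox \<rho> \<sigma> \<and>
          sigmas bs = add_mset \<sigma> (add_mset \<sigma> \<Xi>) \<and> sigmas as = add_mset \<sigma> \<Xi>)"
        by (rule union_boxes_eq_add_mset2E)
      show ?thesis
        using sderiv_boxdia[OF mono[OF boxdia(1) as(2)], of \<psi> \<Theta>]
          sub[OF as(3), of "add_mset \<psi> (ids S \<phi>)"] boxdia(3)
        unfolding neq(2) add_mset_commute[of A "CDia \<phi> \<psi>"] as(1) by simp
    qed
  qed (auto intro: sderiv.andR sderiv.orR1 sderiv.orR2 sderiv.mp_dia)
qed

lemma contraction_mset: "sderiv S (\<Theta> + (\<Theta> + \<Gamma>)) \<Delta> \<Longrightarrow> sderiv S (\<Theta> + \<Gamma>) \<Delta>"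
proof (induction \<Theta> arbitrary: \<Gamma>)
  case (add A \<Theta>)
  then have "sderiv S (\<Theta> + (\<Theta> + add_mset A (add_mset A \<Gamma>))) \<Delta>"
    by simp
  then have "sderiv S (\<Theta> + add_mset A (add_mset A \<Gamma>)) \<Delta>"
    by (rule add.IH)
  then show ?case using contraction by simp
qed simp

subsection \<open>Cut\<close>

text \<open>The premisses of a last rule that introduces the formula on the right. No measure on
  them is recorded, because they only enter cuts on proper components. \<open>boxdia\<close> does
  not appear: its succedent is arbitrary, hence never principal.\<close>

fun right_principal :: "sys \<Rightarrow> 'a fm multiset \<Rightarrow> 'a fm \<Rightarrow> bool" where
  "right_principal S \<Gamma> (Atom p) \<longleftrightarrow> Atom p \<in># \<Gamma>"
| "right_principal S \<Gamma> Bot \<longleftrightarrow> False"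
| "right_principal S \<Gamma> (And \<phi> \<psi>) \<longleftrightarrow> sderiv S \<Gamma> (Some \<phi>) \<and> sderiv S \<Gamma> (Some \<psi>)"
| "right_principal S \<Gamma> (Or \<phi> \<psi>) \<longleftrightarrow> sderiv S \<Gamma> (Some \<phi>) \<or> sderiv S \<Gamma> (Some \<psi>)"
| "right_principal S \<Gamma> (Imp \<phi> \<psi>) \<longleftrightarrow> sderiv S (add_mset \<phi> \<Gamma>) (Some \<psi>)"
| "right_principal S \<Gamma> (CBox \<phi> \<psi>) \<longleftrightarrow>
    (\<exists>\<Theta> bs. \<Gamma> = \<Theta> + boxes bs \<and> equivs S \<phi> bs \<and> sderiv S (ids S \<phi> + sigmas bs) (Some \<psi>))"
| "right_principal S \<Gamma> (CDia \<eta> \<theta>) \<longleftrightarrow>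
    (\<exists>\<phi> \<psi> \<Theta> bs. \<Gamma> = add_mset (CDia \<phi> \<psi>) (\<Theta> + boxes bs) \<and> equivs S \<phi> bs \<and>
      sderiv S {#\<phi>#} (Some \<eta>) \<and> sderiv S {#\<eta>#} (Some \<phi>) \<and>
      sderiv S (ids S \<phi> + add_mset \<psi> (sigmas bs)) (Some \<theta>)) \<or>
    has_mp S \<and> sderiv S \<Gamma> (Some \<eta>) \<and> sderiv S \<Gamma> (Some \<theta>)"

text \<open>Left rules permute below the cut, since they leave the succedent A alone. Premisses of
  \<open>impL\<close> and \<open>mp_box\<close> with another succedent are only weakened by
  \<Gamma>', and \<open>botL\<close> and \<open>boxdia\<close> yield the conclusion without any
  cut.\<close>

lemma cut_left_reduction:
  assumes "sderiv S \<Gamma> (Some A)"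
    and principal: "\<And>\<Gamma>. right_principal S \<Gamma> A \<Longrightarrow> sderiv S (\<Gamma> + \<Gamma>') \<Delta>"
  shows "sderiv S (\<Gamma> + \<Gamma>') \<Delta>"
proof -
  \<comment> \<open>The disjunction makes every right rule, and \<open>init\<close>, satisfy the
    second alternative immediately.\<close>
  have "sderiv S (\<Gamma> + \<Gamma>') \<Delta> \<or> right_principal S \<Gamma> A" if "sderiv S \<Gamma> (Some A)" for \<Gamma>
    using that
  proof (induction \<Gamma> "Some A" rule: sderiv_induct)
    case (andL \<phi> \<psi> \<Gamma>)
    then show ?case using principal sderiv.andL[of S \<phi> \<psi> "\<Gamma> + \<Gamma>'"] by fastforce
  next
    case (orL \<phi> \<Gamma> \<psi>)
    then show ?case using principal sderiv.orL[of S \<phi> "\<Gamma> + \<Gamma>'" \<Delta> \<psi>] by fastforce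
  next
    case (impL \<phi> \<psi> \<Gamma>)
    then show ?case
      using principal weakening[OF impL(1), of \<Gamma>'] sderiv.impL[of S \<phi> \<psi> "\<Gamma> + \<Gamma>'"] by fastforce
  next
    case (mp_box \<phi> \<psi> \<Gamma>)
    then show ?case
      using principal weakening[OF mp_box(2), of \<Gamma>'] sderiv.mp_box[of S \<phi> \<psi> "\<Gamma> + \<Gamma>'"] by fastforce
  next
    case (boxdia bs \<phi> \<psi> \<Gamma>)
    then show ?case using sderiv_boxdia[of S \<phi> bs \<psi> "\<Gamma> + \<Gamma>'"] by (simp add: ac_simps)
  qed (auto intro: sderiv.botL)
  then show ?thesis using assms by blast
qed

text \<open>The hypotheses on A list the ways in which it can be used in the right premiss;
  elsewhere the cut moves up. The other shapes of A need no such reduction: inversion or weakening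
  settles them. The hypothesis \<open>block\<close> ranges over \<chi> because the rule met has its
  own antecedent, only equivalent to \<alpha>; it asks for a block inside \<Gamma> whose \<sigma>'s
  can replace \<beta> in any premiss of that rule. In \<open>mp\<close> the multiset \<Gamma>
  remains next to \<beta>, because \<open>mp_box\<close> keeps the conditional and the inner
  induction has already cut it there.\<close>

lemma cut_right_reduction:
  assumes A: "A = Imp \<alpha> \<beta> \<or> A = CBox \<alpha> \<beta> \<or> A = CDia \<alpha> \<beta>"
    and imp: "\<And>\<Gamma>' \<Delta>. A = Imp \<alpha> \<beta> \<Longrightarrow> sderiv S (\<Gamma> + \<Gamma>') (Some \<alpha>) \<Longrightarrow>
      sderiv S (add_mset \<beta> \<Gamma>') \<Delta> \<Longrightarrow> sderiv S (\<Gamma> + \<Gamma>') \<Delta>"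
    and mp: "\<And>\<Gamma>' \<Delta>. A = CBox \<alpha> \<beta> \<Longrightarrow> has_mp S \<Longrightarrow> sderiv S (\<Gamma> + \<Gamma>') (Some \<alpha>) \<Longrightarrow>
      sderiv S (add_mset \<beta> (\<Gamma> + \<Gamma>')) \<Delta> \<Longrightarrow> sderiv S (\<Gamma> + \<Gamma>') \<Delta>"
    and block: "\<And>\<chi>. A = CBox \<alpha> \<beta> \<Longrightarrow> sderiv S {#\<chi>#} (Some \<alpha>) \<Longrightarrow> sderiv S {#\<alpha>#} (Some \<chi>) \<Longrightarrow>
      \<exists>\<Theta> as. \<Gamma> = \<Theta> + boxes as \<and> equivs S \<chi> as \<and> (\<forall>\<Xi> \<Delta>.
        sderiv S (ids S \<chi> + add_mset \<beta> \<Xi>) \<Delta> \<longrightarrow> sderiv S (ids S \<chi> + (sigmas as + \<Xi>)) \<Delta>)"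
    and dia: "\<And>\<Gamma>' bs \<eta> \<theta>. A = CDia \<alpha> \<beta> \<Longrightarrow> equivs S \<alpha> bs \<Longrightarrow>
      sderiv S {#\<alpha>#} (Some \<eta>) \<Longrightarrow> sderiv S {#\<eta>#} (Some \<alpha>) \<Longrightarrow>
      sderiv S (ids S \<alpha> + add_mset \<beta> (sigmas bs)) (Some \<theta>) \<Longrightarrow>
      sderiv S (\<Gamma> + (\<Gamma>' + boxes bs)) (Some (CDia \<eta> \<theta>))"
    and boxdia: "\<And>\<Gamma>' bs \<Delta>. A = CDia \<alpha> \<beta> \<Longrightarrow> equivs S \<alpha> bs \<Longrightarrow>
      sderiv S (ids S \<alpha> + add_mset \<beta> (sigmas bs)) None \<Longrightarrow>
      sderiv S (\<Gamma> + (\<Gamma>' + boxes bs)) \<Delta>"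
    and "sderiv S (add_mset A \<Gamma>') \<Delta>"
  shows "sderiv S (\<Gamma> + \<Gamma>') \<Delta>"
proof -
  \<comment> \<open>Treats both positions of A at once for all modal rules: in the context it is
    dropped, in the block it is replaced by \<open>as\<close>. The multiset \<open>\<Xi>\<close>
    leaves room for the extra formula \<open>\<psi>\<close> in the premiss of the diamond
    rules.\<close>
  have block': "\<exists>\<Theta> cs. \<Gamma> + \<Gamma>' = \<Theta> + boxes cs \<and> equivs S \<chi> cs \<and> (\<forall>\<Xi> \<Delta>.
      sderiv S (ids S \<chi> + (sigmas bs + \<Xi>)) \<Delta> \<longrightarrow> sderiv S (ids S \<chi> + (sigmas cs + \<Xi>)) \<Delta>)"
    if bs: "\<Gamma>0 + boxes bs = add_mset A \<Gamma>'" and eqs: "equivs S \<chi> bs" for \<Gamma>0 \<Gamma>' \<chi> bs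
    using bs
  proof (cases rule: union_boxes_eq_add_msetE)
    case (side \<Theta>)
    then show ?thesis using eqs by (intro exI[of _ "\<Gamma> + \<Theta>"] exI[of _ bs]) auto
  next
    case (block \<rho> \<sigma> cs)
    with A have "\<rho> = \<alpha>" "\<sigma> = \<beta>" "A = CBox \<alpha> \<beta>" by auto
    with block assms(4)[of \<chi>] equivs_insert[OF eqs block(5)] obtain \<Theta> as where
      "\<Gamma> = \<Theta> + boxes as" "equivs S \<chi> as" and *: "\<And>\<Xi> \<Delta>. sderiv S (ids S \<chi> + add_mset \<beta> \<Xi>) \<Delta> \<Longrightarrow>
        sderiv S (ids S \<chi> + (sigmas as + \<Xi>)) \<Delta>"
      by blast
    moreover have "sderiv S (ids S \<chi> + (sigmas (as @ cs) + \<Xi>)) \<Delta>"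
      if "sderiv S (ids S \<chi> + (sigmas bs + \<Xi>)) \<Delta>" for \<Xi> \<Delta>
      using *[of "sigmas cs + \<Xi>"] that block(3) \<open>\<sigma> = \<beta>\<close> by (simp add: ac_simps)
    moreover have "\<Gamma> + \<Gamma>' = (\<Theta> + \<Gamma>0) + boxes (as @ cs)"
      using block(4) \<open>\<Gamma> = \<Theta> + boxes as\<close> by (simp add: ac_simps)
    ultimately show ?thesis
      using equivs_insert(1)[OF eqs block(5)] equivs_simps(3) by blast
  qed
  from assms(7) show ?thesis
  proof (induction "add_mset A \<Gamma>'" \<Delta> arbitrary: \<Gamma>' rule: sderiv_induct)
    case (init p \<Gamma>0)
    then show ?case by (cases rule: add_mset_eq_add_msetE) (use A in \<open>auto intro: sderiv_init\<close>)
  next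
    case (botL \<Gamma>0)
    then show ?case by (cases rule: add_mset_eq_add_msetE) (use A in \<open>auto intro: sderiv_botL\<close>)
  next
    case (andL \<phi> \<psi> \<Gamma>0 \<Delta>)
    from andL(3) show ?case
    proof (cases rule: add_mset_eq_add_msetE)
      case eq
      then show ?thesis using A by auto
    next
      case (neq \<Xi>)
      then show ?thesis
        using andL(2)[of "add_mset \<phi> (add_mset \<psi> \<Xi>)"]
        by (auto intro!: sderiv.andL simp: add_mset_commute)
    qed
  next
    case (orL \<phi> \<Gamma>0 \<Delta> \<psi>)
    from orL(5) show ?case
    proof (cases rule: add_mset_eq_add_msetE)
      case eq
      then show ?thesis using A by auto
    next
      case (neq \<Xi>)
      then show ?thesis
        using orL(2)[of "add_mset \<phi> \<Xi>"] orL(4)[of "add_mset \<psi> \<Xi>"]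
        by (auto intro!: sderiv.orL simp: add_mset_commute)
    qed
  next
    case (impL \<phi> \<psi> \<Gamma>0 \<Delta>)
    from impL(5) show ?case
    proof (cases rule: add_mset_eq_add_msetE)
      case eq
      then show ?thesis using imp[of \<Gamma>' \<Delta>] impL(2)[of \<Gamma>'] impL(3) A by auto
    next
      case (neq \<Xi>)
      then show ?thesis
        using impL(2)[of "add_mset (Imp \<phi> \<psi>) \<Xi>"] impL(4)[of "add_mset \<psi> \<Xi>"]
        by (auto intro!: sderiv.impL simp: add_mset_commute)
    qed
  next
    case (mp_box \<phi> \<psi> \<Gamma>0 \<Delta>)
    from mp_box(6) show ?case
    proof (cases rule: add_mset_eq_add_msetE)
      case eq
      then show ?thesis
        using mp[of \<Gamma>' \<Delta>] mp_box(1) mp_box(3)[of \<Gamma>'] mp_box(5)[of "add_mset \<psi> \<Gamma>'"] A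
        by (auto simp: add_mset_commute)
    next
      case (neq \<Xi>)
      then show ?thesis
        using mp_box(1) mp_box(3)[of "add_mset (CBox \<phi> \<psi>) \<Xi>"]
          mp_box(5)[of "add_mset \<psi> (add_mset (CBox \<phi> \<psi>) \<Xi>)"]
        by (auto intro!: sderiv.mp_box simp: add_mset_commute)
    qed
  next
    case (impR \<phi> \<psi>)
    then show ?case
      using impR(2)[of "add_mset \<phi> \<Gamma>'"] by (auto intro!: sderiv.impR simp: add_mset_commute)
  next
    case (box bs \<phi> \<psi> \<Gamma>0)
    from block'[OF box(5,1)] obtain \<Theta> cs where cs: "\<Gamma> + \<Gamma>' = \<Theta> + boxes cs" "equivs S \<phi> cs"
      "\<And>\<Xi> \<Delta>. sderiv S (ids S \<phi> + (sigmas bs + \<Xi>)) \<Delta> \<Longrightarrow> sderiv S (ids S \<phi> + (sigmas cs + \<Xi>)) \<Delta>"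
      by blast
    show ?case unfolding cs(1)
      by (rule sderiv_box[OF cs(2)]) (use cs(3)[of "{#}"] box(3) in simp)
  next
    case dia': (dia bs \<phi> \<eta> \<psi> \<theta> \<Gamma>0)
    from dia'(9) show ?case
    proof (cases rule: add_mset_eq_add_msetE)
      case eq
      then have "\<phi> = \<alpha>" "\<psi> = \<beta>" "A = CDia \<alpha> \<beta>" using A by auto
      then show ?thesis using dia[of bs \<eta> \<theta> \<Gamma>0] dia'(1,3,5,7) eq(2) by simp
    next
      case (neq \<Xi>)
      from block'[OF neq(1) dia'(1)] obtain \<Theta> cs where cs: "\<Gamma> + \<Xi> = \<Theta> + boxes cs" "equivs S \<phi> cs"
        "\<And>\<Xi> \<Delta>. sderiv S (ids S \<phi> + (sigmas bs + \<Xi>)) \<Delta> \<Longrightarrow> sderiv S (ids S \<phi> + (sigmas cs + \<Xi>)) \<Delta>"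
        by blast
      show ?thesis
        using sderiv_dia[OF cs(2) dia'(3,5), of \<psi> \<theta> \<Theta>] cs(3)[of "{#\<psi>#}"] dia'(7) cs(1) neq(2)
        by simp
    qed
  next
    case boxdia': (boxdia bs \<phi> \<psi> \<Gamma>0 \<Delta>)
    from boxdia'(5) show ?case
    proof (cases rule: add_mset_eq_add_msetE)
      case eq
      then have "\<phi> = \<alpha>" "\<psi> = \<beta>" "A = CDia \<alpha> \<beta>" using A by auto
      then show ?thesis using boxdia[of bs \<Gamma>0 \<Delta>] boxdia'(1,3) eq(2) by simp
    next
      case (neq \<Xi>)
      from block'[OF neq(1) boxdia'(1)] obtain \<Theta> cs where
        cs: "\<Gamma> + \<Xi> = \<Theta> + boxes cs" "equivs S \<phi> cs"
        "\<And>\<Xi> \<Delta>. sderiv S (ids S \<phi> + (sigmas bs + \<Xi>)) \<Delta> \<Longrightarrow> sderiv S (ids S \<phi> + (sigmas cs + \<Xi>)) \<Delta>"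
        by blast
      show ?thesis
        using sderiv_boxdia[OF cs(2), of \<psi> \<Theta>] cs(3)[of "{#\<psi>#}"] boxdia'(3) cs(1) neq(2)
        by simp
    qed
  qed (auto intro: sderiv.andR sderiv.orR1 sderiv.orR2 sderiv.mp_dia)
qed

text \<open>\<open>mp_box\<close> is applied once per pair. It retains the conditional and the
  context, so the derivation of \<open>\<rho>\<close> only has to be weakened by the \<sigma>'s not
  yet removed.\<close>

lemma mp_box_discharge:
  assumes "has_mp S" "\<forall>(\<rho>, \<sigma>) \<in> set bs. CBox \<rho> \<sigma> \<in># \<Gamma> \<and> sderiv S \<Gamma> (Some \<rho>)"
    and "sderiv S (sigmas bs + \<Gamma>) \<Delta>"
  shows "sderiv S \<Gamma> \<Delta>"
  using assms(2,3)
proof (induction bs)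
  case (Cons b bs)
  obtain \<rho> \<sigma> where b: "b = (\<rho>, \<sigma>)" by force
  then have "CBox \<rho> \<sigma> \<in># sigmas bs + \<Gamma>" using Cons.prems by simp
  then obtain \<Theta> where \<Theta>: "sigmas bs + \<Gamma> = add_mset (CBox \<rho> \<sigma>) \<Theta>" by (metis multi_member_split)
  have "sderiv S (sigmas bs + \<Gamma>) (Some \<rho>)"
    using Cons.prems b weakening_subset[of S \<Gamma> "Some \<rho>" "sigmas bs + \<Gamma>"] by simp
  then have "sderiv S (sigmas bs + \<Gamma>) \<Delta>"
    using Cons.prems(2) b sderiv.mp_box[OF assms(1), of \<rho> \<sigma> \<Theta> \<Delta>] \<Theta> by simp
  then show ?case using Cons by simp
qed simp

section \<open>Admissibility of cut\<close>

theorem cut: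
  assumes "sderiv S \<Gamma> (Some A)" "sderiv S (add_mset A \<Gamma>') \<Delta>"
  shows "sderiv S (\<Gamma> + \<Gamma>') \<Delta>"
  using assms
proof (induction A arbitrary: \<Gamma> \<Gamma>' \<Delta> rule: measure_induct_rule[of size])
  case (less A)
  \<comment> \<open>Cut with separate contexts doubles the common context; contraction merges the
    copies.\<close>
  have shared: "sderiv S \<Gamma> \<Delta>"
    if "size \<phi> < size A" "sderiv S \<Gamma> (Some \<phi>)" "sderiv S (add_mset \<phi> \<Gamma>) \<Delta>" for \<phi> :: "'a fm" and \<Gamma> \<Delta>
    using less.IH[OF that] contraction_mset[of S \<Gamma> "{#}"] by simp
  have trans: "sderiv S {#\<chi>#} (Some \<rho>)"
    if "size \<phi> < size A" "sderiv S {#\<chi>#} (Some \<phi>)" "sderiv S {#\<phi>#} (Some \<rho>)" for \<phi> \<chi> \<rho> :: "'a fm"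
    using less.IH[OF that(1,2), of "{#}"] that(3) by simp
  \<comment> \<open>Moves a block from \<phi> to an equivalent antecedent \<chi> by composing each
    equivalence with \<phi> as intermediate formula.\<close>
  have equivs_trans: "equivs S \<chi> bs"
    if "size \<phi> < size A" "sderiv S {#\<chi>#} (Some \<phi>)" "sderiv S {#\<phi>#} (Some \<chi>)" "equivs S \<phi> bs"
    for \<phi> \<chi> :: "'a fm" and bs
  proof -
    have "sderiv S {#\<rho>#} (Some \<chi>)" if "sderiv S {#\<rho>#} (Some \<phi>)" for \<rho>
      using less.IH[OF \<open>size \<phi> < size A\<close> that, of "{#}"] \<open>sderiv S {#\<phi>#} (Some \<chi>)\<close> by simp
    then show ?thesis using that trans[OF that(1,2)] by (fastforce simp: equivs_def)
  qed
  \<comment> \<open>Merging the premisses of two identity rules leaves both antecedents in the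
    sequent; as \<chi> derives \<phi>, the latter is cut away.\<close>
  have ids_trans: "sderiv S (ids S \<chi> + \<Theta>) \<Delta>"
    if "size \<phi> < size A" "sderiv S {#\<chi>#} (Some \<phi>)" "sderiv S (ids S \<phi> + (ids S \<chi> + \<Theta>)) \<Delta>"
    for \<phi> \<chi> :: "'a fm" and \<Theta> \<Delta>
    using that less.IH[OF that(1,2), of "add_mset \<chi> \<Theta>" \<Delta>] contraction[of S \<chi> \<Theta> \<Delta>]
    by (cases "has_id S") (simp_all add: ids_def add_mset_commute)
  have ids_shared: "sderiv S \<Gamma> \<Delta>"
    if "size \<phi> < size A" "sderiv S \<Gamma> (Some \<phi>)" "sderiv S (ids S \<phi> + \<Gamma>) \<Delta>" for \<phi> :: "'a fm" and \<Gamma> \<Delta>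
    using that shared[OF that(1,2)] by (cases "has_id S") (simp_all add: ids_def)
  show ?case
  proof (rule cut_left_reduction[OF less.prems(1)])
    fix \<Gamma>
    assume rp: "right_principal S \<Gamma> A"
    show "sderiv S (\<Gamma> + \<Gamma>') \<Delta>"
    proof (cases A)
      case (Atom p)
      \<comment> \<open>The atom already occurs in \<Gamma>, so the right premiss weakens to the
        goal.\<close>
      then obtain \<Theta> where "\<Gamma> = add_mset A \<Theta>" using rp multi_member_split[of A \<Gamma>] by auto
      then show ?thesis
        using weakening_subset[OF less.prems(2), of "\<Gamma> + \<Gamma>'"] by simp
    next
      case Bot
      then show ?thesis using rp by simp
    next
      case (And \<phi> \<psi>)
      have "sderiv S ({#\<phi>, \<psi>#} + \<Gamma>') \<Delta>"
        by (rule left_inversion[OF less.prems(2)]) (simp add: And left_part.intros)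
      then have "sderiv S (\<Gamma> + add_mset \<psi> \<Gamma>') \<Delta>"
        using less.IH[of \<phi> \<Gamma> "add_mset \<psi> \<Gamma>'"] rp And by simp
      then show ?thesis
        using shared[of \<psi> "\<Gamma> + \<Gamma>'"] rp And weakening[of S \<Gamma> "Some \<psi>" \<Gamma>'] by simp
    next
      case (Or \<phi> \<psi>)
      have "sderiv S ({#\<phi>#} + \<Gamma>') \<Delta>" "sderiv S ({#\<psi>#} + \<Gamma>') \<Delta>"
        by (rule left_inversion[OF less.prems(2)], simp add: Or left_part.intros)+
      then show ?thesis using rp Or less.IH[of \<phi> \<Gamma> \<Gamma>'] less.IH[of \<psi> \<Gamma> \<Gamma>'] by auto
    next
      case (Imp \<phi> \<psi>)
      show ?thesis
      proof (rule cut_right_reduction[OF _ _ _ _ _ _ less.prems(2)])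
        fix \<Gamma>' \<Delta>
        assume "sderiv S (\<Gamma> + \<Gamma>') (Some \<phi>)" "sderiv S (add_mset \<psi> \<Gamma>') \<Delta>"
        moreover have "sderiv S (add_mset \<phi> (\<Gamma> + \<Gamma>')) (Some \<psi>)"
          using rp Imp weakening[of S "add_mset \<phi> \<Gamma>" "Some \<psi>" \<Gamma>'] by simp
        ultimately have "sderiv S (\<Gamma> + \<Gamma>') (Some \<psi>)" "sderiv S (add_mset \<psi> (\<Gamma> + \<Gamma>')) \<Delta>"
          using shared[of \<phi> "\<Gamma> + \<Gamma>'"] weakening_subset[of S "add_mset \<psi> \<Gamma>'" \<Delta>] Imp by simp_all
        then show "sderiv S (\<Gamma> + \<Gamma>') \<Delta>" using shared[of \<psi>] Imp by simp
      qed (use Imp in auto)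
    next
      case (CBox \<phi> \<psi>)
      then obtain \<Theta> bs where bs: "\<Gamma> = \<Theta> + boxes bs" "equivs S \<phi> bs"
        "sderiv S (ids S \<phi> + sigmas bs) (Some \<psi>)"
        using rp by auto
      have size: "size \<phi> < size A" "size \<psi> < size A" using CBox by simp_all
      show ?thesis
      proof (rule cut_right_reduction[OF _ _ _ _ _ _ less.prems(2)])
        fix \<Gamma>' \<Delta>
        assume mp: "has_mp S" "sderiv S (\<Gamma> + \<Gamma>') (Some \<phi>)" "sderiv S (add_mset \<psi> (\<Gamma> + \<Gamma>')) \<Delta>"
        \<comment> \<open>Cutting \<psi> against the premiss of the box rule brings in the
          \<sigma>'s of the block and possibly \<phi>; the derivation of \<phi> removes the latter,
          and the \<sigma>'s are discharged.\<close>
        have "sderiv S (ids S \<phi> + (sigmas bs + (\<Gamma> + \<Gamma>'))) \<Delta>"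
          using less.IH[OF size(2) bs(3) mp(3)] by (simp add: ac_simps)
        then have "sderiv S (sigmas bs + (\<Gamma> + \<Gamma>')) \<Delta>"
          by (rule ids_shared[OF size(1), rotated]) (rule weakening_subset[OF mp(2)], simp)
        moreover have "CBox \<rho> \<sigma> \<in># \<Gamma> + \<Gamma>' \<and> sderiv S (\<Gamma> + \<Gamma>') (Some \<rho>)" if "(\<rho>, \<sigma>) \<in> set bs" for \<rho> \<sigma>
        proof
          show "CBox \<rho> \<sigma> \<in># \<Gamma> + \<Gamma>'" using that bs(1) by (force simp: boxes_def)
          have "sderiv S {#\<phi>#} (Some \<rho>)" using that bs(2) by (auto simp: equivs_def)
          then show "sderiv S (\<Gamma> + \<Gamma>') (Some \<rho>)" using less.IH[OF size(1) mp(2), of "{#}"] by simp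
        qed
        ultimately show "sderiv S (\<Gamma> + \<Gamma>') \<Delta>" using mp_box_discharge[OF mp(1)] by blast
      next
        fix \<chi>
        assume \<chi>: "sderiv S {#\<chi>#} (Some \<phi>)" "sderiv S {#\<phi>#} (Some \<chi>)"
        have "sderiv S (ids S \<chi> + (sigmas bs + \<Xi>)) \<Delta>"
          if "sderiv S (ids S \<chi> + add_mset \<psi> \<Xi>) \<Delta>" for \<Xi> \<Delta>
          using less.IH[OF size(2) bs(3), of "ids S \<chi> + \<Xi>" \<Delta>] that
          by (intro ids_trans[OF size(1) \<chi>(1)]) (simp add: ac_simps)
        then show "\<exists>\<Theta> as. \<Gamma> = \<Theta> + boxes as \<and> equivs S \<chi> as \<and> (\<forall>\<Xi> \<Delta>.
          sderiv S (ids S \<chi> + add_mset \<psi> \<Xi>) \<Delta> \<longrightarrow> sderiv S (ids S \<chi> + (sigmas as + \<Xi>)) \<Delta>)"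
          using bs(1) equivs_trans[OF size(1) \<chi> bs(2)] by blast
      qed (use CBox in auto)
    next
      case (CDia \<phi> \<psi>)
      have size: "size \<phi> < size A" "size \<psi> < size A" using CDia by simp_all
      \<comment> \<open>The left premiss ends in \<open>mp_dia\<close>. The succedent is kept
        general, so that the cases of \<open>dia\<close> and \<open>boxdia\<close> on the right are
        both instances.\<close>
      have mp: "sderiv S (\<Gamma> + (\<Gamma>' + boxes bs)) \<Delta> \<and> sderiv S (\<Gamma> + (\<Gamma>' + boxes bs)) (Some \<phi>)"
        if "has_mp S" "sderiv S \<Gamma> (Some \<phi>)" "sderiv S \<Gamma> (Some \<psi>)" "equivs S \<phi> bs"
          "sderiv S (ids S \<phi> + add_mset \<psi> (sigmas bs)) \<Delta>" for \<Gamma>' bs \<Delta>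
      proof -
        let ?M = "\<Gamma> + (\<Gamma>' + boxes bs)"
        have M: "sderiv S ?M (Some \<phi>)" "sderiv S ?M (Some \<psi>)" using that weakening by blast+
        have "sderiv S (ids S \<phi> + (sigmas bs + ?M)) \<Delta>"
          using less.IH[OF size(2) M(2), of "ids S \<phi> + sigmas bs"] that(5) by (simp add: ac_simps)
        then have "sderiv S (sigmas bs + ?M) \<Delta>"
          by (rule ids_shared[OF size(1), rotated]) (rule weakening_subset[OF M(1)], simp)
        moreover have "CBox \<rho> \<sigma> \<in># ?M \<and> sderiv S ?M (Some \<rho>)" if "(\<rho>, \<sigma>) \<in> set bs" for \<rho> \<sigma>
        proof
          show "CBox \<rho> \<sigma> \<in># ?M" using that by (force simp: boxes_def)
          have "sderiv S {#\<phi>#} (Some \<rho>)" using that \<open>equivs S \<phi> bs\<close> by (auto simp: equivs_def)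
          then show "sderiv S ?M (Some \<rho>)" using less.IH[OF size(1) M(1), of "{#}"] by simp
        qed
        ultimately show ?thesis using mp_box_discharge[OF that(1)] M(1) by blast
      qed
      \<comment> \<open>The left premiss ends in \<open>dia\<close>: a cut on \<psi> joins the two
        premisses over the concatenated blocks, with \<chi> as the surviving antecedent.\<close>
      have dia: "sderiv S (ids S \<chi> + add_mset \<zeta> (sigmas (as @ bs))) \<Delta>"
        if "sderiv S {#\<chi>#} (Some \<phi>)" "sderiv S (ids S \<chi> + add_mset \<zeta> (sigmas as)) (Some \<psi>)"
          "sderiv S (ids S \<phi> + add_mset \<psi> (sigmas bs)) \<Delta>" for \<chi> \<zeta> as bs \<Delta>
        using less.IH[OF size(2) that(2), of "ids S \<phi> + sigmas bs" \<Delta>] that(3)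
        by (intro ids_trans[OF size(1) that(1)]) (simp add: ac_simps)
      show ?thesis
      proof (rule cut_right_reduction[OF _ _ _ _ _ _ less.prems(2)])
        fix \<Gamma>' bs \<eta> \<theta>
        assume *: "equivs S \<phi> bs" "sderiv S {#\<phi>#} (Some \<eta>)" "sderiv S {#\<eta>#} (Some \<phi>)"
          "sderiv S (ids S \<phi> + add_mset \<psi> (sigmas bs)) (Some \<theta>)"
        from rp CDia consider
          (dia) \<chi> \<zeta> \<Theta> as where "\<Gamma> = add_mset (CDia \<chi> \<zeta>) (\<Theta> + boxes as)" "equivs S \<chi> as"
            "sderiv S {#\<chi>#} (Some \<phi>)" "sderiv S {#\<phi>#} (Some \<chi>)"
            "sderiv S (ids S \<chi> + add_mset \<zeta> (sigmas as)) (Some \<psi>)"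
          | (mp) "has_mp S" "sderiv S \<Gamma> (Some \<phi>)" "sderiv S \<Gamma> (Some \<psi>)"
          by auto
        then show "sderiv S (\<Gamma> + (\<Gamma>' + boxes bs)) (Some (CDia \<eta> \<theta>))"
        proof cases
          case dia'': dia
          \<comment> \<open>The equivalence of \<chi> and \<eta> passes through \<phi>, the
            antecedent of the cut formula; it licenses a single \<open>dia\<close> from
            \<open>CDia \<chi> \<zeta>\<close>.\<close>
          have "sderiv S {#\<eta>#} (Some \<chi>)"
            using less.IH[OF size(1) *(3), of "{#}"] dia''(4) by simp
          then have "sderiv S (add_mset (CDia \<chi> \<zeta>) ((\<Theta> + \<Gamma>') + boxes (as @ bs))) (Some (CDia \<eta> \<theta>))"
            using dia''(2) equivs_trans[OF size(1) dia''(3,4) *(1)] trans[OF size(1) dia''(3) *(2)]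
            by (intro sderiv_dia dia[OF dia''(3,5) *(4)]) simp_all
          then show ?thesis using dia''(1) by (simp add: ac_simps)
        next
          case mp'': mp
          have "sderiv S (\<Gamma> + (\<Gamma>' + boxes bs)) (Some \<theta>)" "sderiv S (\<Gamma> + (\<Gamma>' + boxes bs)) (Some \<phi>)"
            using mp[OF mp'' *(1,4)] by simp_all
          moreover from this(2) have "sderiv S (\<Gamma> + (\<Gamma>' + boxes bs)) (Some \<eta>)"
            using less.IH[OF size(1) _, of _ "{#}"] *(2) by fastforce
          ultimately show ?thesis using mp''(1) by (intro sderiv.mp_dia)
        qed
      next
        fix \<Gamma>' bs \<Delta>
        assume *: "equivs S \<phi> bs" "sderiv S (ids S \<phi> + add_mset \<psi> (sigmas bs)) None"
        from rp CDia consider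
          (dia) \<chi> \<zeta> \<Theta> as where "\<Gamma> = add_mset (CDia \<chi> \<zeta>) (\<Theta> + boxes as)" "equivs S \<chi> as"
            "sderiv S {#\<chi>#} (Some \<phi>)" "sderiv S {#\<phi>#} (Some \<chi>)"
            "sderiv S (ids S \<chi> + add_mset \<zeta> (sigmas as)) (Some \<psi>)"
          | (mp) "has_mp S" "sderiv S \<Gamma> (Some \<phi>)" "sderiv S \<Gamma> (Some \<psi>)"
          by auto
        then show "sderiv S (\<Gamma> + (\<Gamma>' + boxes bs)) \<Delta>"
        proof cases
          case dia'': dia
          have "sderiv S (add_mset (CDia \<chi> \<zeta>) ((\<Theta> + \<Gamma>') + boxes (as @ bs))) \<Delta>"
            using dia''(2) equivs_trans[OF size(1) dia''(3,4) *(1)]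
            by (intro sderiv_boxdia dia[OF dia''(3,5) *(2)]) simp_all
          then show ?thesis using dia''(1) by (simp add: ac_simps)
        next
          case mp'': mp
          have "sderiv S (\<Gamma> + (\<Gamma>' + boxes bs)) None"
            using mp[OF mp'' *] by simp
          then show ?thesis by (rule weakening_right)
        qed
      qed (use CDia in auto)
    qed
  qed
qed

subsection \<open>From the Hilbert systems to the calculi\<close>

text \<open>\<open>init\<close> covers atoms only. For a conditional, reflexivity of the antecedent
  supplies the equivalence premisses and reflexivity of the consequent the remaining one.\<close>

lemma sderiv_add_mset_refl: "sderiv S (add_mset A \<Gamma>) (Some A)"
proof (induction A arbitrary: \<Gamma>)
  case (And \<phi> \<psi>)
  show ?case
    using And(1)[of "add_mset \<psi> \<Gamma>"] And(2)[of "add_mset \<phi> \<Gamma>"]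
    by (intro sderiv.andL sderiv.andR) (simp_all add: add_mset_commute)
next
  case (Imp \<phi> \<psi>)
  have "sderiv S (add_mset (Imp \<phi> \<psi>) (add_mset \<phi> \<Gamma>)) (Some \<psi>)"
  proof (rule sderiv.impL)
    show "sderiv S (add_mset (Imp \<phi> \<psi>) (add_mset \<phi> \<Gamma>)) (Some \<phi>)"
      using Imp(1)[of "add_mset (Imp \<phi> \<psi>) \<Gamma>"] by (simp add: add_mset_commute)
  qed (rule Imp(2))
  then show ?case by (intro sderiv.impR) (simp add: add_mset_commute)
next
  case (CBox \<phi> \<psi>)
  show ?case
    using sderiv_box[of S \<phi> "[(\<phi>, \<psi>)]" \<psi> \<Gamma>] CBox(1)[of "{#}"] CBox(2)[of "ids S \<phi>"] by simp
next
  case (CDia \<phi> \<psi>)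
  show ?case
    using sderiv_dia[of S \<phi> "[]" \<phi> \<psi> \<psi> \<Gamma>] CDia(1)[of "{#}"] CDia(2)[of "ids S \<phi>"] by simp
next
  case (Or \<phi> \<psi>)
  show ?case
    by (rule sderiv.orL[OF sderiv.orR1[OF Or(1)] sderiv.orR2[OF Or(2)]])
qed (rule sderiv.init sderiv.botL)+

lemma sderiv_refl: "A \<in># \<Gamma> \<Longrightarrow> sderiv S \<Gamma> (Some A)"
  by (metis multi_member_split sderiv_add_mset_refl)

lemma cut_shared:
  assumes "sderiv S \<Gamma> (Some A)" "sderiv S (add_mset A \<Gamma>) \<Delta>"
  shows "sderiv S \<Gamma> \<Delta>"
  using cut[OF assms] contraction_mset[of S \<Gamma> "{#}" \<Delta>] by simp

text \<open>With cut the calculus has the elimination rules of natural deduction, in which the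
  Hilbert axioms are easily checked; this one also simulates modus ponens.\<close>

lemma sderiv_impE:
  assumes "sderiv S \<Gamma> (Some (Imp \<phi> \<psi>))" "sderiv S \<Gamma> (Some \<phi>)"
  shows "sderiv S \<Gamma> (Some \<psi>)"
proof (rule cut_shared[OF assms(1)], rule sderiv.impL)
  show "sderiv S (add_mset (Imp \<phi> \<psi>) \<Gamma>) (Some \<phi>)"
    using weakening_subset[OF assms(2)] by simp
qed (rule sderiv_add_mset_refl)

lemma sderiv_andE:
  assumes "sderiv S \<Gamma> (Some (And \<phi> \<psi>))"
  shows "sderiv S \<Gamma> (Some \<phi>)" "sderiv S \<Gamma> (Some \<psi>)"
  by (rule cut_shared[OF assms], rule sderiv.andL, rule sderiv_refl, simp)+

lemma sderiv_orE:
  assumes "sderiv S \<Gamma> (Some (Or \<phi> \<psi>))" "sderiv S (add_mset \<phi> \<Gamma>) \<Delta>" "sderiv S (add_mset \<psi> \<Gamma>) \<Delta>"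
  shows "sderiv S \<Gamma> \<Delta>"
  by (rule cut_shared[OF assms(1)], rule sderiv.orL) (fact assms)+

lemma sderiv_empty_impD: "sderiv S {#} (Some (Imp \<phi> \<psi>)) \<Longrightarrow> sderiv S {#\<phi>#} (Some \<psi>)"
  using sderiv_impE[of S "{#\<phi>#}" \<phi> \<psi>] weakening[of S "{#}" _ "{#\<phi>#}"] sderiv_refl[of \<phi> "{#\<phi>#}" S]
  by simp

text \<open>Turns the premiss of a Hilbert congruence rule into the pair of sequents that the modal
  rules take as equivalence premisses.\<close>

lemma sderiv_Iff:
  "sderiv S {#} (Some (Iff \<phi> \<psi>)) \<longleftrightarrow> sderiv S {#\<phi>#} (Some \<psi>) \<and> sderiv S {#\<psi>#} (Some \<phi>)"
proof
  assume "sderiv S {#} (Some (Iff \<phi> \<psi>))"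
  then show "sderiv S {#\<phi>#} (Some \<psi>) \<and> sderiv S {#\<psi>#} (Some \<phi>)"
    unfolding Iff_def by (intro conjI sderiv_empty_impD) (erule sderiv_andE)+
next
  assume "sderiv S {#\<phi>#} (Some \<psi>) \<and> sderiv S {#\<psi>#} (Some \<phi>)"
  then show "sderiv S {#} (Some (Iff \<phi> \<psi>))"
    unfolding Iff_def by (intro sderiv.andR sderiv.impR) simp_all
qed

text \<open>A block with one pair; varying antecedent and consequent together serves
  \<open>RA_box\<close>, \<open>RC_box\<close> and \<open>CM_box\<close> alike.\<close>

lemma box_mono:
  assumes "sderiv S {#\<phi>#} (Some \<rho>)" "sderiv S {#\<rho>#} (Some \<phi>)" "sderiv S {#\<sigma>#} (Some \<psi>)"
  shows "sderiv S {#CBox \<rho> \<sigma>#} (Some (CBox \<phi> \<psi>))"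
  using sderiv_box[of S \<phi> "[(\<rho>, \<sigma>)]" \<psi> "{#}"] assms weakening[OF assms(3), of "ids S \<phi>"] by simp

lemma dia_mono:
  assumes "sderiv S {#\<phi>#} (Some \<rho>)" "sderiv S {#\<rho>#} (Some \<phi>)" "sderiv S {#\<sigma>#} (Some \<psi>)"
  shows "sderiv S {#CDia \<rho> \<sigma>#} (Some (CDia \<phi> \<psi>))"
  using sderiv_dia[of S \<rho> "[]" \<phi> \<sigma> \<psi> "{#}"] assms weakening[OF assms(3), of "ids S \<rho>"] by simp

theorem hderiv_imp_sderiv: "hderiv S A \<Longrightarrow> sderiv S {#} (Some A)"
proof (induction rule: hderiv.induct)
  case (A1 S \<phi> \<psi>)
  show ?case by (intro sderiv.impR sderiv_refl) simp
next
  case (A2 S \<phi> \<psi> \<chi>)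
  let ?\<Gamma> = "{#\<phi>, Imp \<phi> \<psi>, Imp \<phi> (Imp \<psi> \<chi>)#}"
  have "sderiv S ?\<Gamma> (Some (Imp \<psi> \<chi>))" "sderiv S ?\<Gamma> (Some \<psi>)"
    by (rule sderiv_impE[of _ _ \<phi>]; rule sderiv_refl; simp)+
  then have "sderiv S ?\<Gamma> (Some \<chi>)" by (rule sderiv_impE)
  then show ?case by (intro sderiv.impR)
next
  case (A3 S \<phi> \<psi>)
  show ?case by (intro sderiv.impR sderiv_andE(1)[of _ _ \<phi> \<psi>] sderiv_refl) simp
next
  case (A4 S \<phi> \<psi>)
  show ?case by (intro sderiv.impR sderiv_andE(2)[of _ _ \<phi> \<psi>] sderiv_refl) simp
next
  case (A5 S \<phi> \<psi>)
  show ?case by (intro sderiv.impR sderiv.andR sderiv_refl) simp_all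
next
  case (A6 S \<phi> \<psi>)
  show ?case by (intro sderiv.impR sderiv.orR1 sderiv_refl) simp
next
  case (A7 S \<psi> \<phi>)
  show ?case by (intro sderiv.impR sderiv.orR2 sderiv_refl) simp
next
  case (A8 S \<phi> \<chi> \<psi>)
  let ?\<Gamma> = "{#Or \<phi> \<psi>, Imp \<psi> \<chi>, Imp \<phi> \<chi>#}"
  have "sderiv S (add_mset \<phi> ?\<Gamma>) (Some \<chi>)"
    by (rule sderiv_impE[of _ _ \<phi>]; rule sderiv_refl; simp)
  moreover have "sderiv S (add_mset \<psi> ?\<Gamma>) (Some \<chi>)"
    by (rule sderiv_impE[of _ _ \<psi>]; rule sderiv_refl; simp)
  ultimately have "sderiv S ?\<Gamma> (Some \<chi>)"
    by (rule sderiv_orE[OF sderiv_refl, rotated]) simp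
  then show ?case by (intro sderiv.impR)
next
  case (A9 S \<phi>)
  show ?case by (intro sderiv.impR sderiv.botL)
next
  case (MP S \<phi> \<psi>)
  show ?case by (rule sderiv_impE[OF MP.IH])
next
  case (CM_box S \<phi> \<psi> \<chi>)
  have "sderiv S {#And \<psi> \<chi>#} (Some \<psi>)" "sderiv S {#And \<psi> \<chi>#} (Some \<chi>)"
    using sderiv_andE[of S "{#And \<psi> \<chi>#}" \<psi> \<chi>] by (simp_all add: sderiv_refl)
  then show ?case by (intro sderiv.impR sderiv.andR box_mono) (simp_all add: sderiv_refl)
next
  case (CC_box S \<phi> \<psi> \<chi>)
  \<comment> \<open>Two pairs with the same antecedent form the block, so both consequents are
    available in one premiss.\<close>
  have "sderiv S {#CBox \<phi> \<psi>, CBox \<phi> \<chi>#} (Some (CBox \<phi> (And \<psi> \<chi>)))"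
    using sderiv_box[of S \<phi> "[(\<phi>, \<psi>), (\<phi>, \<chi>)]" "And \<psi> \<chi>" "{#}"]
    by (simp add: sderiv_refl sderiv.andR)
  then show ?case by (intro sderiv.impR sderiv.andL)
next
  case (CN_box S \<phi>)
  show ?case
    using sderiv_box[of S \<phi> "[]" Top "{#}"] by (simp add: Top_def Neg_def sderiv.impR sderiv.botL)
next
  case (CN_dia S \<phi>)
  show ?case
    using sderiv_boxdia[of S \<phi> "[]" Bot "{#}"] by (simp add: Neg_def sderiv.impR sderiv.botL)
next
  case (CK_dia S \<phi> \<psi> \<chi>)
  have "sderiv S (ids S \<phi> + {#\<psi>, Imp \<psi> \<chi>#}) (Some \<chi>)"
    by (rule sderiv_impE[of _ _ \<psi>]; rule sderiv_refl; simp)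
  then have "sderiv S {#CDia \<phi> \<psi>, CBox \<phi> (Imp \<psi> \<chi>)#} (Some (CDia \<phi> \<chi>))"
    using sderiv_dia[of S \<phi> "[(\<phi>, Imp \<psi> \<chi>)]" \<phi> \<psi> \<chi> "{#}"] by (simp add: sderiv_refl)
  then show ?case by (intro sderiv.impR)
next
  case (ID_box S \<phi>)
  then show ?case using sderiv_box[of S \<phi> "[]" \<phi> "{#}"] by (simp add: ids_def sderiv_refl)
next
  case (MP_box S \<phi> \<psi>)
  have "sderiv S {#CBox \<phi> \<psi>, \<phi>#} (Some \<psi>)"
    by (rule sderiv.mp_box[OF MP_box]) (simp_all add: sderiv_refl)
  then show ?case by (intro sderiv.impR) (simp add: add_mset_commute)
next
  case (MP_dia S \<phi> \<psi>)
  then show ?case by (intro sderiv.impR sderiv.andL sderiv.mp_dia) (simp_all add: sderiv_refl)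
qed (auto simp: sderiv_Iff sderiv_refl intro!: box_mono dia_mono)

subsection \<open>From the calculi to the Hilbert systems\<close>

text \<open>Modus ponens is the only rule that acts on assumptions; the congruence rules stay inside
  \<open>hderiv\<close>. Hence \<open>A1\<close> and \<open>A2\<close> suffice for the deduction
  theorem.\<close>

inductive hent :: "sys \<Rightarrow> 'a fm set \<Rightarrow> 'a fm \<Rightarrow> bool" for S X where
  assum: "A \<in> X \<Longrightarrow> hent S X A"
| provable: "hderiv S A \<Longrightarrow> hent S X A"
| mp: "hent S X (Imp A B) \<Longrightarrow> hent S X A \<Longrightarrow> hent S X B"

lemma hderiv_imp_refl: "hderiv S (Imp A A)"
  by (rule MP[OF MP[OF A2 A1] A1[of _ _ A]])

lemma hent_deduction: "hent S (insert A X) B \<Longrightarrow> hent S X (Imp A B)"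
proof (induction rule: hent.induct)
  case (assum B)
  then show ?case using hent.provable[OF hderiv_imp_refl] hent.mp[OF hent.provable[OF A1] hent.assum] by blast
next
  case (provable B)
  then show ?case by (blast intro: hent.intros A1)
next
  case (mp B C)
  then show ?case by (blast intro: hent.mp[OF hent.mp[OF hent.provable[OF A2]]])
qed

lemma hent_subst: "hent S X A \<Longrightarrow> (\<And>B. B \<in> X \<Longrightarrow> hent S Y B) \<Longrightarrow> hent S Y A"
  by (induction rule: hent.induct) (auto intro: hent.intros)

lemma hent_mono: "hent S X A \<Longrightarrow> X \<subseteq> Y \<Longrightarrow> hent S Y A"
  by (erule hent_subst) (auto intro: hent.assum)

lemma hent_empty_iff: "hent S {} A \<longleftrightarrow> hderiv S A"
proof
  show "hent S {} A \<Longrightarrow> hderiv S A"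
    by (induction rule: hent.induct) (auto intro: hderiv.MP)
qed (rule hent.provable)

lemma hent_singleton_iff: "hent S {A} B \<longleftrightarrow> hderiv S (Imp A B)"
  by (meson hent_deduction hent_empty_iff hent.assum hent.mp hent.provable singletonI)

lemma hent_andI: "hent S X A \<Longrightarrow> hent S X B \<Longrightarrow> hent S X (And A B)"
  by (blast intro: hent.mp[OF hent.mp[OF hent.provable[OF A5]]])

lemma hent_andE:
  "hent S X (And A B) \<Longrightarrow> hent S X A" "hent S X (And A B) \<Longrightarrow> hent S X B"
  by (blast intro: hent.mp[OF hent.provable[OF A3]] hent.mp[OF hent.provable[OF A4]])+

lemma hent_Iff: "hent S {A} B \<Longrightarrow> hent S {B} A \<Longrightarrow> hderiv S (Iff A B)"
  unfolding Iff_def hent_empty_iff[symmetric] by (intro hent_andI hent_deduction)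

lemma hent_IffD: "hderiv S (Iff A B) \<Longrightarrow> hent S X A \<Longrightarrow> hent S X B"
  unfolding Iff_def by (blast intro: hent.mp hent_andE(1) hent.provable)

section \<open>Soundness of the modal rules\<close>

text \<open>The system has only congruence in the consequent. Since A entails B, A is equivalent to
  \<open>And A B\<close>; \<open>RC_box\<close> rewrites to the conjunction and
  \<open>CM_box\<close> projects to B.\<close>

lemma hent_box_mono:
  assumes "hent S {A} B" "hent S X (CBox \<phi> A)"
  shows "hent S X (CBox \<phi> B)"
proof -
  have "hderiv S (Iff A (And A B))"
    by (rule hent_Iff) (auto intro: hent_andI assms hent_andE hent.assum)
  then have "hent S X (CBox \<phi> (And A B))" using RC_box hent_IffD assms(2) by blast
  then show ?thesis by (blast intro: hent_andE(2) hent.mp hent.provable CM_box)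
qed

text \<open>Under a fixed antecedent the box behaves as a normal modality: \<open>CN_box\<close>
  with monotonicity handles theorems, \<open>CC_box\<close> handles modus ponens.\<close>

lemma hent_box:
  assumes "hent S Y A" "\<And>B. B \<in> Y \<Longrightarrow> hent S X (CBox \<phi> B)"
  shows "hent S X (CBox \<phi> A)"
  using assms
proof (induction rule: hent.induct)
  case (provable A)
  then show ?case by (blast intro: hent_box_mono[of S Top] hent.provable CN_box)
next
  case (mp A B)
  then have "hent S X (CBox \<phi> (And (Imp A B) A))"
    by (blast intro: hent.mp[OF hent.provable[OF CC_box]] hent_andI)
  then show ?case
    by (rule hent_box_mono[rotated]) (blast intro: hent.mp hent_andE hent.assum)
qed blast

text \<open>Covers the box rule in all systems: \<open>RA_box\<close> aligns each
  \<open>\<rho>\<close> with \<phi>, and \<open>ID_box\<close> pays for the extra antecedent when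
  there is one.\<close>

lemma hent_box_block:
  assumes "\<forall>(\<rho>, \<sigma>) \<in> set bs. hent S {\<phi>} \<rho> \<and> hent S {\<rho>} \<phi>"
    and "hent S (set_mset (ids S \<phi> + sigmas bs)) A" "set_mset (boxes bs) \<subseteq> X"
  shows "hent S X (CBox \<phi> A)"
proof (rule hent_box[OF assms(2)])
  fix B
  assume "B \<in> set_mset (ids S \<phi> + sigmas bs)"
  then consider "has_id S" "B = \<phi>" | \<rho> where "(\<rho>, B) \<in> set bs"
    by (auto simp: ids_def sigmas_def split: if_splits)
  then show "hent S X (CBox \<phi> B)"
  proof cases
    case 1
    then show ?thesis by (simp add: hent.provable ID_box)
  next
    case 2
    then have "hderiv S (Iff \<rho> \<phi>)" "CBox \<rho> B \<in> X"
      using assms(1,3) by (auto intro: hent_Iff simp: boxes_def)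
    then show ?thesis by (blast intro: hent_IffD RA_box hent.assum)
  qed
qed

text \<open>The deduction theorem turns \<psi> into the premiss of an implication, the box rule
  boxes it, and \<open>CK_dia\<close> applies it under the diamond. It serves both
  \<open>dia\<close> and \<open>boxdia\<close>.\<close>

lemma hent_dia_block:
  assumes "\<forall>(\<rho>, \<sigma>) \<in> set bs. hent S {\<phi>} \<rho> \<and> hent S {\<rho>} \<phi>"
    and "hent S (set_mset (ids S \<phi> + add_mset \<psi> (sigmas bs))) A"
  shows "hent S (set_mset (add_mset (CDia \<phi> \<psi>) (\<Gamma> + boxes bs))) (CDia \<phi> A)"
proof -
  have "hent S (set_mset (ids S \<phi> + sigmas bs)) (Imp \<psi> A)"
    using assms(2) by (intro hent_deduction) simp
  then have "hent S (set_mset (add_mset (CDia \<phi> \<psi>) (\<Gamma> + boxes bs))) (CBox \<phi> (Imp \<psi> A))"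
    by (rule hent_box_block[OF assms(1)]) auto
  then show ?thesis by (blast intro: hent.mp[OF hent.mp[OF hent.provable[OF CK_dia]]] hent.assum union_single_eq_member)
qed

theorem sderiv_imp_hent: "sderiv S \<Gamma> \<Delta> \<Longrightarrow> hent S (set_mset \<Gamma>) (bigOr \<Delta>)"
proof (induction rule: sderiv_induct)
  case (init p \<Gamma>)
  show ?case by (simp add: hent.assum)
next
  case (botL \<Gamma> \<Delta>)
  show ?case by (rule hent.mp[OF hent.provable[OF A9]]) (simp add: hent.assum)
next
  case (andL \<phi> \<psi> \<Gamma> \<Delta>)
  have "hent S (set_mset (add_mset (And \<phi> \<psi>) \<Gamma>)) (And \<phi> \<psi>)" by (simp add: hent.assum)
  then show ?case
    by (intro hent_subst[OF andL.IH]) (auto intro: hent_andE hent.assum)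
next
  case (orL \<phi> \<Gamma> \<Delta> \<psi>)
  have "hent S (set_mset \<Gamma>) (Imp (Or \<phi> \<psi>) (bigOr \<Delta>))"
    by (rule hent.mp[OF hent.mp[OF hent.provable[OF A8]]]; rule hent_deduction; use orL in simp)
  then have "hent S (set_mset (add_mset (Or \<phi> \<psi>) \<Gamma>)) (Imp (Or \<phi> \<psi>) (bigOr \<Delta>))"
    by (rule hent_mono) auto
  then show ?case by (rule hent.mp) (simp add: hent.assum)
next
  case (impL \<phi> \<psi> \<Gamma> \<Delta>)
  let ?X = "set_mset (add_mset (Imp \<phi> \<psi>) \<Gamma>)"
  have "hent S ?X (Imp \<phi> \<psi>)" by (simp add: hent.assum)
  then have "hent S ?X \<psi>" using impL.IH(1) by (auto intro: hent.mp)
  then show ?case by (intro hent_subst[OF impL.IH(2)]) (auto intro: hent.assum)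
next
  case (mp_box \<phi> \<psi> \<Gamma> \<Delta>)
  let ?X = "set_mset (add_mset (CBox \<phi> \<psi>) \<Gamma>)"
  have "hent S ?X (CBox \<phi> \<psi>)" by (simp add: hent.assum)
  then have "hent S ?X \<psi>"
    using mp_box by (auto intro: hent.mp[OF hent.mp[OF hent.provable[OF MP_box]]])
  then show ?case by (intro hent_subst[OF mp_box.IH(2)]) (auto intro: hent.assum)
next
  case (box bs \<phi> \<psi> \<Gamma>)
  have "hent S (set_mset (\<Gamma> + boxes bs)) (CBox \<phi> \<psi>)"
    by (rule hent_box_block[of bs]) (use box in auto)
  then show ?case by simp
next
  case (dia bs \<phi> \<eta> \<psi> \<theta> \<Gamma>)
  have "hderiv S (Iff (CDia \<phi> \<theta>) (CDia \<eta> \<theta>))"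
    using dia by (intro RA_dia hent_Iff) simp_all
  moreover have "hent S (set_mset (add_mset (CDia \<phi> \<psi>) (\<Gamma> + boxes bs))) (CDia \<phi> \<theta>)"
    by (rule hent_dia_block) (use dia in auto)
  ultimately show ?case using hent_IffD by auto
next
  case (boxdia bs \<phi> \<psi> \<Gamma> \<Delta>)
  \<comment> \<open>An empty succedent reads as \<open>Bot\<close>, so the block yields
    \<open>CDia \<phi> Bot\<close>, which \<open>CN_dia\<close> refutes; any succedent
    follows.\<close>
  have "hent S (set_mset (add_mset (CDia \<phi> \<psi>) (\<Gamma> + boxes bs))) (CDia \<phi> Bot)"
    by (rule hent_dia_block) (use boxdia in auto)
  then show ?case
    using hent.mp[OF hent.provable[OF A9] hent.mp[OF hent.provable[OF CN_dia[unfolded Neg_def]]]] by blast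
next
  case (andR \<Gamma> \<phi> \<psi>)
  then show ?case by (simp add: hent_andI)
next
  case (orR1 \<Gamma> \<phi> \<psi>)
  then show ?case by (auto intro: hent.mp[OF hent.provable[OF A6]])
next
  case (orR2 \<Gamma> \<psi> \<phi>)
  then show ?case by (auto intro: hent.mp[OF hent.provable[OF A7]])
next
  case (impR \<phi> \<Gamma> \<psi>)
  then show ?case by (simp add: hent_deduction)
next
  case (mp_dia \<Gamma> \<phi> \<psi>)
  then show ?case by (auto intro: hent.mp[OF hent.provable[OF MP_dia]] hent_andI)
qed

lemma hent_bigAnd: "hent S X (bigAnd xs) \<Longrightarrow> A \<in> set xs \<Longrightarrow> hent S X A"
  by (induction xs rule: bigAnd.induct) (auto intro: hent_andE)

lemma sderiv_bigAnd: "set xs \<subseteq> set_mset \<Gamma> \<Longrightarrow> sderiv S \<Gamma> (Some (bigAnd xs))"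
  by (induction xs rule: bigAnd.induct)
    (auto simp: Top_def Neg_def intro: sderiv.impR sderiv.botL sderiv.andR sderiv_refl)

text \<open>An empty succedent is recovered by cutting \<open>Bot\<close> against
  \<open>botL\<close>.\<close>

lemma sderiv_bigOr: "sderiv S \<Gamma> (Some (bigOr \<Delta>)) \<Longrightarrow> sderiv S \<Gamma> \<Delta>"
  using cut_shared[OF _ sderiv.botL] by (cases \<Delta>) auto

theorem theorem11:
  fixes S :: sys and \<Gamma> :: "'a fm multiset" and \<Delta> :: "'a fm option" and xs :: "'a fm list"
  assumes "mset xs = \<Gamma>"
  shows "sderiv S \<Gamma> \<Delta> \<longleftrightarrow> hderiv S (iota xs \<Delta>)"
proof
  assume "sderiv S \<Gamma> \<Delta>"
  then have *: "hent S (set xs) (bigOr \<Delta>)"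
    using sderiv_imp_hent assms by (metis set_mset_mset)
  show "hderiv S (iota xs \<Delta>)"
  proof (cases "xs = []")
    case True
    then show ?thesis using * by (simp add: iota_def hent_empty_iff)
  next
    case False
    have "hent S {bigAnd xs} (bigOr \<Delta>)"
      by (rule hent_subst[OF *]) (rule hent_bigAnd[OF hent.assum], simp_all)
    then show ?thesis using False by (simp add: iota_def hent_singleton_iff)
  qed
next
  assume "hderiv S (iota xs \<Delta>)"
  then have *: "sderiv S \<Gamma> (Some (iota xs \<Delta>))"
    using hderiv_imp_sderiv weakening[of S "{#}" _ \<Gamma>] by fastforce
  \<comment> \<open>\<Gamma> derives the conjunction of its own members, so the implication can be
    eliminated; for an empty antecedent there is none to eliminate.\<close>
  have "sderiv S \<Gamma> (Some (bigOr \<Delta>))"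
  proof (cases "xs = []")
    case True
    then show ?thesis using * by (simp add: iota_def)
  next
    case False
    then show ?thesis
      using * sderiv_impE[of S \<Gamma> "bigAnd xs"] sderiv_bigAnd[of xs \<Gamma> S] assms
      by (auto simp: iota_def)
  qed
  then show "sderiv S \<Gamma> \<Delta>" by (rule sderiv_bigOr)
qed

end
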